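(* Consider the Curie-Weiss model with $h=0$, $\beta=1$, i.e. the probability measures $$\mu_N(\sigma)=\frac{1}{Z_N}\exp\Big(\frac{1}{2N}\sum_{i,j=1}^N\sigma_i\sigma_j\Big),\qquad \sigma\in\{-1,+1\}^N,$$ with $Z_N$ the normalizing constant. Let $\xi$ be a real random variable with density $$f_1(x)=\frac{\exp(-\frac1{12}x^4)}{\int_{\mathbb R}\exp(-\frac1{12}y^4)\,dy},\qquad x\in\mathbb R .$$ Then there is $\delta_0\in(0,\frac1{20}]$ such that for every $0<\delta<\delta_0$ the following holds. Put $\xi_N:=\xi\,\mathbf 1\{|\xi|\le N^\delta\}$ and, for all $N$, let $$\nu_N(\sigma):=\mathbb E_{\xi_N}\prod_{i=1}^N\frac12\Big(1+\frac{\xi_N\sigma_i}{\sqrt[4]{N}}\Big),\qquad \sigma\in\{-1,+1\}^N.$$ Then, as $N\to\infty$, $$H(\mu_N|\nu_N)\to 0\qquad\text{as well as}\qquad H(\nu_N|\mu_N)\to 0.$$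
   Context: Relative entropy of probability measures: $H(\varrho|\pi)=\int\log\frac{d\varrho}{d\pi}\,d\varrho$ if $\varrho\ll\pi$, and $+\infty$ otherwise. $\mathbb E_{\xi_N}$ denotes expectation with respect to $\xi_N$. *)

theory Defs
  imports "HOL-Probability.Probability"
begin

text \<open>For measures on a common \<open>\<sigma>\<close>-algebra. Note the argument order of the library
  constants: the reference measure \<open>\<pi>\<close> comes first. The Bochner integral underlying
  \<^const>\<open>KL_divergence\<close> is \<open>0\<close> for non-integrable functions; since the negative part of the
  log-density is always \<open>\<rho>\<close>-integrable for probability measures, non-integrability means
  that the relative entropy is \<open>\<infinity>\<close>.\<close>

definition rel_entropy :: "'a measure \<Rightarrow> 'a measure \<Rightarrow> ereal" where
  "rel_entropy \<rho> \<pi> =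
    (if absolutely_continuous \<pi> \<rho> \<and> integrable \<rho> (entropy_density (exp 1) \<pi> \<rho>)
     then ereal (KL_divergence (exp 1) \<pi> \<rho>) else \<infinity>)"

definition configs :: "nat \<Rightarrow> (nat \<Rightarrow> real) set" where
  "configs N = {1..N} \<rightarrow>\<^sub>E {-1, 1}"

definition cw_weight :: "nat \<Rightarrow> (nat \<Rightarrow> real) \<Rightarrow> real" where
  "cw_weight N \<sigma> = exp (1 / (2 * real N) * (\<Sum>i\<in>{1..N}. \<Sum>j\<in>{1..N}. \<sigma> i * \<sigma> j))"

definition cw_Z :: "nat \<Rightarrow> real" where
  "cw_Z N = (\<Sum>\<sigma>\<in>configs N. cw_weight N \<sigma>)"

definition cw_measure :: "nat \<Rightarrow> (nat \<Rightarrow> real) measure" where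
  "cw_measure N = point_measure (configs N) (\<lambda>\<sigma>. ennreal (cw_weight N \<sigma> / cw_Z N))"

definition quartic_density :: "real \<Rightarrow> real" where
  "quartic_density x = exp (- (1/12) * x ^ 4) / (LINT y|lborel. exp (- (1/12) * y ^ 4))"

definition trunc_rv :: "('w \<Rightarrow> real) \<Rightarrow> real \<Rightarrow> nat \<Rightarrow> 'w \<Rightarrow> real" where
  "trunc_rv \<xi> \<delta> N \<omega> = \<xi> \<omega> * indicator {\<omega>'. \<bar>\<xi> \<omega>'\<bar> \<le> real N powr \<delta>} \<omega>"

text \<open>For \<open>N \<ge> 1\<close> and \<open>0 < \<delta> \<le> 1/4\<close> every factor below is nonnegative, so \<^const>\<open>ennreal\<close>
  truncates nothing in the measure built from these weights.\<close>

definition mix_weight :: "'w measure \<Rightarrow> ('w \<Rightarrow> real) \<Rightarrow> nat \<Rightarrow> (nat \<Rightarrow> real) \<Rightarrow> real" where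
  "mix_weight M X N \<sigma> =
    (LINT \<omega>|M. (\<Prod>i\<in>{1..N}. 1/2 * (1 + X \<omega> * \<sigma> i / root 4 (real N))))"

definition mix_measure :: "'w measure \<Rightarrow> ('w \<Rightarrow> real) \<Rightarrow> nat \<Rightarrow> (nat \<Rightarrow> real) measure" where
  "mix_measure M X N = point_measure (configs N) (\<lambda>\<sigma>. ennreal (mix_weight M X N \<sigma>))"

end

theory Submission
  imports Defs "HOL-Real_Asymp.Real_Asymp"
begin

text \<open>Let \<open>q\<^sub>m\<close> be the law of independent spins of mean \<open>m\<close>. By the Hubbard--Stratonovich
  transformation \<open>\<mu>\<^sub>N\<close> is the mixture of the laws \<open>q\<close> at \<open>m = tanh t\<close> with respect to the
  density proportional to \<open>\<rho>(t)\<^sup>N\<close>, where \<open>\<rho>(t) = exp(-t\<^sup>2/2) cosh t\<close>. Substituting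
  \<open>y = N\<^bsup>1/4\<^esup> tanh t\<close>, the measure \<open>\<nu>\<^sub>N\<close> is, up to an atom at \<open>m = 0\<close> of mass
  \<open>p = P(|\<xi>| > N\<^sup>\<delta>)\<close>, the mixture restricted to \<open>|t| \<le> a\<close>, \<open>tanh a = N\<^bsup>\<delta>-1/4\<^esup>\<close>. Since
  \<open>ln \<rho>(t) = -tanh\<^sup>4 t / 12 + O(t\<^sup>6)\<close>, the two densities agree there up to a factor tending to
  \<open>1\<close>, and what \<open>\<mu>\<^sub>N\<close> gives to \<open>|t| > a\<close> is superpolynomially small, as is \<open>p\<close>.

  As \<open>\<mu>\<^sub>N(\<sigma>) \<ge> 1/Z\<^sub>N\<close> is at least of order \<open>2\<^bsup>-N\<^esup> N\<^bsup>-1/2\<^esup>\<close>, the atom is negligible and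
  \<open>\<nu>\<^sub>N / \<mu>\<^sub>N \<le> 1 + o(1)\<close> uniformly, which bounds \<open>H(\<nu>\<^sub>N|\<mu>\<^sub>N)\<close>. For \<open>H(\<mu>\<^sub>N|\<nu>\<^sub>N)\<close> the part of
  \<open>\<mu>\<^sub>N\<close> from \<open>|t| \<le> a\<close> is at most \<open>(1 + o(1)) \<nu>\<^sub>N\<close>, and the rest contributes at most its mass
  times \<open>1 + N ln 4\<close>, because \<open>\<nu>\<^sub>N(\<sigma>) \<ge> 4\<^bsup>-N\<^esup>\<close>.\<close>

section \<open>Relative entropy of finite distributions\<close>

text \<open>Positive weights on a finite set give absolute continuity and integrability at once, so
  the infinite branch of \<open>rel_entropy\<close> is never taken. Both measures are densities with
  respect to \<open>count_space A\<close>, where the integral is a finite sum.\<close>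

lemma rel_entropy_point_measure:
  fixes p q :: "'a \<Rightarrow> real"
  assumes "finite A" and p: "\<And>x. x \<in> A \<Longrightarrow> 0 < p x" and q: "\<And>x. x \<in> A \<Longrightarrow> 0 < q x"
  shows "rel_entropy (point_measure A (\<lambda>x. ennreal (p x))) (point_measure A (\<lambda>x. ennreal (q x)))
    = ereal (\<Sum>x\<in>A. p x * ln (p x / q x))"
proof -
  interpret sigma_finite_measure "count_space A"
    by (rule sigma_finite_measure_count_space_finite) fact
  have ac: "absolutely_continuous (point_measure A (\<lambda>x. ennreal (q x)))
      (point_measure A (\<lambda>x. ennreal (p x)))"
    by (rule absolutely_continuousI_point_measure_finite) (use q in \<open>force+\<close>)
  have le: "0 \<le> p x" "0 \<le> q x" "q x \<noteq> 0" if "x \<in> A" for x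
    using p[OF that] q[OF that] by auto
  have "KL_divergence (exp 1) (density (count_space A) q) (density (count_space A) p)
      = (\<integral>x. p x * log (exp 1) (p x / q x) \<partial>count_space A)"
    by (rule KL_density_density) (auto simp: AE_count_space le)
  also have "\<dots> = (\<Sum>x\<in>A. p x * ln (p x / q x))"
    using \<open>finite A\<close> by (simp add: lebesgue_integral_count_space_finite log_def)
  finally show ?thesis
    using ac integrable_point_measure_finite[OF \<open>finite A\<close>, of p]
    by (simp add: rel_entropy_def point_measure_def)
qed

text \<open>Gibbs' inequality: applying ln u \<le> u - 1 to u = q/p bounds each term below by p - q,
  and these differences sum to zero.\<close>

lemma relative_entropy_sum_nonneg:
  fixes p q :: "'a \<Rightarrow> real"
  assumes "\<And>x. x \<in> A \<Longrightarrow> 0 < p x" and "\<And>x. x \<in> A \<Longrightarrow> 0 < q x"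
    and "(\<Sum>x\<in>A. p x) = (\<Sum>x\<in>A. q x)"
  shows "0 \<le> (\<Sum>x\<in>A. p x * ln (p x / q x))"
proof -
  have "p x - q x \<le> p x * ln (p x / q x)" if "x \<in> A" for x
  proof -
    have "ln (q x / p x) \<le> q x / p x - 1"
      using assms that by (intro ln_le_minus_one) simp
    then have "p x * ln (q x / p x) \<le> p x * (q x / p x - 1)"
      using assms(1)[OF that] by (intro mult_left_mono) auto
    then show ?thesis
      using assms(1,2)[OF that] by (simp add: ln_div right_diff_distrib)
  qed
  then have "(\<Sum>x\<in>A. p x - q x) \<le> (\<Sum>x\<in>A. p x * ln (p x / q x))"
    by (rule sum_mono)
  then show ?thesis
    using assms(3) by (simp add: sum_subtractf)
qed

lemma relative_entropy_sum_le_ln: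
  fixes p q :: "'a \<Rightarrow> real"
  assumes "\<And>x. x \<in> A \<Longrightarrow> 0 < p x" and "\<And>x. x \<in> A \<Longrightarrow> 0 < q x" and "(\<Sum>x\<in>A. p x) = 1"
    and "\<And>x. x \<in> A \<Longrightarrow> p x \<le> c * q x"
  shows "(\<Sum>x\<in>A. p x * ln (p x / q x)) \<le> ln c"
proof -
  have "p x * ln (p x / q x) \<le> p x * ln c" if "x \<in> A" for x
  proof -
    have "p x / q x \<le> c"
      using assms(2,4)[OF that] by (simp add: pos_divide_le_eq)
    moreover have "0 < p x / q x"
      using assms(1,2)[OF that] by simp
    ultimately have "ln (p x / q x) \<le> ln c"
      using ln_le_cancel_iff[of "p x / q x" c] by linarith
    then show ?thesis
      using assms(1)[OF that] by (intro mult_left_mono) auto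
  qed
  then have "(\<Sum>x\<in>A. p x * ln (p x / q x)) \<le> (\<Sum>x\<in>A. p x * ln c)"
    by (rule sum_mono)
  also have "\<dots> = ln c"
    using assms(3) by (simp flip: sum_distrib_right)
  finally show ?thesis .
qed

text \<open>The logarithm splits as ln (p1/q) + ln (1 + p2/p1). Weighted by p1, the second summand
  costs at most p2. Weighted by p2, the whole logarithm is at most c by the crude bound. Together
  this gives the factor 1 + c in front of the mass of p2.\<close>

lemma relative_entropy_sum_le_ln_plus_tail:
  fixes p1 p2 q :: "'a \<Rightarrow> real"
  assumes p1: "\<And>x. x \<in> A \<Longrightarrow> 0 < p1 x" and p2: "\<And>x. x \<in> A \<Longrightarrow> 0 \<le> p2 x"
    and q: "\<And>x. x \<in> A \<Longrightarrow> 0 < q x"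
    and sum1: "(\<Sum>x\<in>A. p1 x + p2 x) = 1"
    and main: "\<And>x. x \<in> A \<Longrightarrow> p1 x \<le> b * q x" and "1 \<le> b"
    and crude: "\<And>x. x \<in> A \<Longrightarrow> p1 x + p2 x \<le> exp c * q x"
  shows "(\<Sum>x\<in>A. (p1 x + p2 x) * ln ((p1 x + p2 x) / q x)) \<le> ln b + (1 + c) * (\<Sum>x\<in>A. p2 x)"
proof -
  have "(p1 x + p2 x) * ln ((p1 x + p2 x) / q x) \<le> (p1 x + p2 x) * ln b + (1 + c) * p2 x"
    if x: "x \<in> A" for x
  proof -
    let ?p = "p1 x + p2 x"
    note pos = p1[OF x] p2[OF x] q[OF x]
    have "ln (p1 x / q x) \<le> ln b"
      using pos main[OF x] \<open>1 \<le> b\<close> by (subst ln_le_cancel_iff) (auto simp: pos_divide_le_eq)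
    moreover have "ln (?p / p1 x) \<le> p2 x / p1 x"
      using pos ln_add_one_self_le_self[of "p2 x / p1 x"] by (simp add: add_divide_distrib)
    moreover have "ln (?p / q x) = ln (p1 x / q x) + ln (?p / p1 x)"
      using pos by (simp add: ln_div add_pos_nonneg)
    ultimately have "p1 x * ln (?p / q x) \<le> p1 x * (ln b + p2 x / p1 x)"
      using pos by (intro mult_left_mono) auto
    also have "\<dots> = p1 x * ln b + p2 x"
      using pos by (simp add: distrib_left)
    finally have 1: "p1 x * ln (?p / q x) \<le> p1 x * ln b + p2 x" .
    have "ln (?p / q x) \<le> ln (exp c)"
      using pos crude[OF x] by (subst ln_le_cancel_iff) (auto simp: pos_divide_le_eq add_pos_nonneg)
    then have "p2 x * ln (?p / q x) \<le> p2 x * c"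
      using pos by (intro mult_left_mono) auto
    \<comment> \<open>Adding this nonnegative term completes p1 ln b to (p1 + p2) ln b, which sums
      to exactly ln b. This is where \<open>1 \<le> b\<close> enters.\<close>
    moreover have "0 \<le> p2 x * ln b"
      using pos \<open>1 \<le> b\<close> by simp
    ultimately show ?thesis
      using 1 by (simp add: algebra_simps)
  qed
  then have "(\<Sum>x\<in>A. (p1 x + p2 x) * ln ((p1 x + p2 x) / q x))
      \<le> (\<Sum>x\<in>A. (p1 x + p2 x) * ln b + (1 + c) * p2 x)"
    by (rule sum_mono)
  also have "\<dots> = ln b + (1 + c) * (\<Sum>x\<in>A. p2 x)"
    by (simp only: sum.distrib flip: sum_distrib_left sum_distrib_right)
       (use sum1 in \<open>simp add: sum.distrib\<close>)
  finally show ?thesis .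
qed

section \<open>Laws of independent spins\<close>

definition spin_law :: "nat \<Rightarrow> real \<Rightarrow> (nat \<Rightarrow> real) \<Rightarrow> real" where
  "spin_law N m \<sigma> = (\<Prod>i\<in>{1..N}. 1/2 * (1 + m * \<sigma> i))"

lemma finite_configs: "finite (configs N)"
  unfolding configs_def by (intro finite_PiE) auto

lemma configs_spin: "\<sigma> \<in> configs N \<Longrightarrow> i \<in> {1..N} \<Longrightarrow> \<sigma> i = -1 \<or> \<sigma> i = 1"
  unfolding configs_def by (blast dest: PiE_mem)

text \<open>The sum over a product set factorizes over the sites, and the two values at each site
  add up to 1, whatever the real number m.\<close>

lemma sum_spin_law: "(\<Sum>\<sigma>\<in>configs N. spin_law N m \<sigma>) = 1"
proof -
  have "(\<Sum>\<sigma>\<in>configs N. spin_law N m \<sigma>) = (\<Prod>i\<in>{1..N}. \<Sum>s\<in>{-1, 1}. 1/2 * (1 + m * s))"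
    unfolding configs_def spin_law_def by (rule prod_sum_PiE[symmetric]) auto
  then show ?thesis by (simp flip: add_divide_distrib)
qed

lemma spin_law_bounds:
  assumes "\<sigma> \<in> configs N" and "\<bar>m\<bar> \<le> c" "c \<le> 1"
  shows "((1 - c) / 2) ^ N \<le> spin_law N m \<sigma>" and "spin_law N m \<sigma> \<le> 1"
proof -
  have *: "(1 - c) / 2 \<le> 1/2 * (1 + m * \<sigma> i)" "1/2 * (1 + m * \<sigma> i) \<le> 1" if "i \<in> {1..N}" for i
    using configs_spin[OF assms(1) that] assms(2,3) by auto
  have nonneg: "0 \<le> 1/2 * (1 + m * \<sigma> i)" if "i \<in> {1..N}" for i
    using *(1)[OF that] \<open>c \<le> 1\<close> by auto
  have "(\<Prod>i\<in>{1..N}. (1 - c) / 2) \<le> spin_law N m \<sigma>"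
    unfolding spin_law_def using * assms by (intro prod_mono) auto
  then show "((1 - c) / 2) ^ N \<le> spin_law N m \<sigma>"
    by simp
  have "spin_law N m \<sigma> \<le> (\<Prod>i\<in>{1..N}. 1)"
    unfolding spin_law_def using * nonneg by (intro prod_mono) blast
  then show "spin_law N m \<sigma> \<le> 1"
    by simp
qed

lemma spin_law_unit_interval:
  assumes "\<sigma> \<in> configs N" and "\<bar>m\<bar> \<le> 1"
  shows "0 \<le> spin_law N m \<sigma>" and "spin_law N m \<sigma> \<le> 1" and "\<bar>spin_law N m \<sigma>\<bar> \<le> 1"
proof -
  have "0 \<le> ((1 - 1) / 2 :: real) ^ N"
    by (rule zero_le_power) simp
  then show "0 \<le> spin_law N m \<sigma>" "spin_law N m \<sigma> \<le> 1"
    using spin_law_bounds[OF assms order.refl] by linarith+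
  then show "\<bar>spin_law N m \<sigma>\<bar> \<le> 1"
    by simp
qed

lemma spin_law_0: "spin_law N 0 \<sigma> = (1/2) ^ N"
  by (simp add: spin_law_def)

lemma continuous_on_spin_law: "continuous_on A (\<lambda>m. spin_law N m \<sigma>)"
  unfolding spin_law_def by (intro continuous_intros)

text \<open>Exponential tilting: exp (t s) = cosh t (1 + s tanh t) for s = 1 and s = -1, so a field
  t produces independent spins of mean tanh t.\<close>

lemma spin_law_tanh:
  assumes "\<sigma> \<in> configs N"
  shows "exp (t * (\<Sum>i\<in>{1..N}. \<sigma> i)) = 2 ^ N * cosh t ^ N * spin_law N (tanh t) \<sigma>"
proof -
  have *: "exp (t * \<sigma> i) = 2 * cosh t * (1/2 * (1 + tanh t * \<sigma> i))" if "i \<in> {1..N}" for i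
  proof -
    have [simp]: "cosh t * tanh t = sinh t"
      by (simp add: tanh_def)
    show ?thesis
      using configs_spin[OF assms that]
      by (auto simp: distrib_left right_diff_distrib cosh_plus_sinh cosh_minus_sinh)
  qed
  have "exp (t * (\<Sum>i\<in>{1..N}. \<sigma> i)) = (\<Prod>i\<in>{1..N}. exp (t * \<sigma> i))"
    by (simp add: sum_distrib_left exp_sum)
  also have "\<dots> = (\<Prod>i\<in>{1..N}. 2 * cosh t * (1/2 * (1 + tanh t * \<sigma> i)))"
    by (intro prod.cong refl *)
  also have "\<dots> = (2 * cosh t) ^ N * spin_law N (tanh t) \<sigma>"
    unfolding prod.distrib spin_law_def by simp
  finally show ?thesis by (simp add: power_mult_distrib)
qed

section \<open>The function \<open>exp(-t\<^sup>2/2) cosh t\<close>\<close>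

text \<open>Its N-th power is the unnormalized mixing density on the t-axis, the function \<rho> of
  the overview.\<close>

definition cw_profile :: "real \<Rightarrow> real" where
  "cw_profile t = exp (- (t ^ 2 / 2)) * cosh t"

lemma cw_profile_pos: "0 < cw_profile t"
  by (simp add: cw_profile_def cosh_real_pos)

lemma cw_profile_minus: "cw_profile (- t) = cw_profile t"
  by (simp add: cw_profile_def)

lemma cw_profile_0: "cw_profile 0 = 1"
  by (simp add: cw_profile_def)

lemma continuous_on_cw_profile: "continuous_on A cw_profile"
  unfolding cw_profile_def by (intro continuous_intros) auto

lemma tanh_real_le_self: "0 \<le> (t::real) \<Longrightarrow> tanh t \<le> t"
proof -
  assume "0 \<le> t"
  have "0 - tanh 0 \<le> t - tanh t"
  proof (rule DERIV_nonneg_imp_nondecreasing[OF \<open>0 \<le> t\<close>])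
    show "\<exists>y. ((\<lambda>x. x - tanh x) has_real_derivative y) (at x) \<and> 0 \<le> y" for x :: real
      by (rule exI[of _ "tanh x ^ 2"]) (auto intro!: derivative_eq_intros)
  qed
  then show ?thesis by simp
qed

text \<open>The derivative has the sign of sinh x - x cosh x, which is nonpositive because tanh x
  \<le> x for x \<ge> 0.\<close>

lemma cw_profile_antimono:
  assumes "0 \<le> s" "s \<le> t"
  shows "cw_profile t \<le> cw_profile s"
proof (rule DERIV_nonpos_imp_nonincreasing[OF \<open>s \<le> t\<close>])
  fix x assume "s \<le> x"
  have "tanh x \<le> x"
    using assms \<open>s \<le> x\<close> by (intro tanh_real_le_self) auto
  then have "sinh x \<le> x * cosh x"
    by (simp add: tanh_def pos_divide_le_eq cosh_real_pos)
  then have "exp (- (x ^ 2 / 2)) * (sinh x - x * cosh x) \<le> 0"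
    by (intro mult_nonneg_nonpos) auto
  moreover have "(cw_profile has_real_derivative exp (- (x ^ 2 / 2)) * (sinh x - x * cosh x)) (at x)"
    unfolding cw_profile_def [abs_def]
    by (auto intro!: derivative_eq_intros simp: algebra_simps)
  ultimately show "\<exists>y. (cw_profile has_real_derivative y) (at x) \<and> y \<le> 0"
    by blast
qed

lemma cw_profile_le_1: "cw_profile t \<le> 1"
proof (cases "0 \<le> t")
  case True
  then show ?thesis using cw_profile_antimono[of 0 t] by (simp add: cw_profile_0)
next
  case False
  then show ?thesis using cw_profile_antimono[of 0 "-t"] by (simp add: cw_profile_0 cw_profile_minus)
qed

text \<open>With \<open>s = tanh t\<close> the function \<open>s + s\<^sup>3/3 - s\<^sup>5/3 - t\<close> is the derivative of
  \<open>ln (cw_profile t) + s\<^sup>4/12\<close>.\<close>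

lemma tanh_taylor_bounds:
  fixes t :: real
  assumes "0 \<le> t"
  shows "tanh t + tanh t ^ 3 / 3 - tanh t ^ 5 / 3 - t \<le> 0"
    and "- (8/15) * t ^ 5 \<le> tanh t + tanh t ^ 3 / 3 - tanh t ^ 5 / 3 - t"
proof -
  let ?k = "\<lambda>t::real. tanh t + tanh t ^ 3 / 3 - tanh t ^ 5 / 3 - t"
  have k: "(?k has_real_derivative 5/3 * tanh x ^ 6 - 8/3 * tanh x ^ 4) (at x)" for x
  proof -
    have "(?k has_real_derivative (1 - tanh x ^ 2) + 3 * tanh x ^ 2 * (1 - tanh x ^ 2) / 3
        - 5 * tanh x ^ 4 * (1 - tanh x ^ 2) / 3 - 1) (at x)"
      by (auto intro!: derivative_eq_intros)
    moreover have "(1 - y ^ 2) + 3 * y ^ 2 * (1 - y ^ 2) / 3 - 5 * y ^ 4 * (1 - y ^ 2) / 3 - 1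
        = 5/3 * y ^ 6 - 8/3 * y ^ 4" for y :: real
      by (simp add: field_simps flip: power_add)
    ultimately show ?thesis by simp
  qed
  have tanh4: "0 \<le> tanh x ^ 4" "tanh x ^ 6 \<le> tanh x ^ 4" "0 \<le> tanh x ^ 6" for x :: real
  proof -
    have "tanh x ^ 2 \<le> 1"
      using tanh_real_bounds[of x] by (simp add: abs_square_le_1 abs_le_iff)
    then have "tanh x ^ 4 * tanh x ^ 2 \<le> tanh x ^ 4 * 1"
      by (intro mult_left_mono) auto
    then show "0 \<le> tanh x ^ 4" "tanh x ^ 6 \<le> tanh x ^ 4" "0 \<le> tanh x ^ 6"
      by (auto simp flip: power_add)
  qed
  have "?k t \<le> ?k 0"
  proof (rule DERIV_nonpos_imp_nonincreasing[OF assms])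
    show "\<exists>y. (?k has_real_derivative y) (at x) \<and> y \<le> 0" for x
      by (rule exI, rule conjI[OF k]) (use tanh4[of x] in linarith)
  qed
  then show "?k t \<le> 0" by simp
  \<comment> \<open>The derivative of \<open>?k\<close> is at least -8/3 tanh^4 x, hence at least
    -8/3 x^4; integrating gives the constant 8/15.\<close>
  have "?k 0 + 8/15 * 0 ^ 5 \<le> ?k t + 8/15 * t ^ 5"
  proof (rule DERIV_nonneg_imp_nondecreasing[OF assms])
    fix x :: real assume "0 \<le> x"
    have der: "((\<lambda>x. ?k x + 8/15 * x ^ 5) has_real_derivative 5/3 * tanh x ^ 6 - 8/3 * tanh x ^ 4 + 8/3 * x ^ 4)
        (at x)"
      by (rule DERIV_add[OF k]) (auto intro!: derivative_eq_intros)
    have "tanh x ^ 4 \<le> x ^ 4"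
      using \<open>0 \<le> x\<close> by (intro power_mono tanh_real_le_self) auto
    then have "0 \<le> 5/3 * tanh x ^ 6 - 8/3 * tanh x ^ 4 + 8/3 * x ^ 4"
      using tanh4[of x] by linarith
    with der show "\<exists>y. ((\<lambda>x. ?k x + 8/15 * x ^ 5) has_real_derivative y) (at x) \<and> 0 \<le> y"
      by blast
  qed
  then show "- (8/15) * t ^ 5 \<le> ?k t" by simp
qed

text \<open>The function \<open>?h\<close> is the error of the quartic approximation to ln
  \<open>cw_profile\<close>. It vanishes at 0 and its derivative is \<open>?k\<close>, so the
  preceding two-sided bound on \<open>?k\<close> only has to be integrated.\<close>

lemma cw_profile_bounds_nonneg:
  assumes "0 \<le> t"
  shows "cw_profile t \<le> exp (- (tanh t ^ 4 / 12))"
    and "exp (- (tanh t ^ 4 / 12) - t ^ 6) \<le> cw_profile t"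
proof -
  let ?h = "\<lambda>t::real. ln (cosh t) - t ^ 2 / 2 + tanh t ^ 4 / 12"
  let ?k = "\<lambda>t::real. tanh t + tanh t ^ 3 / 3 - tanh t ^ 5 / 3 - t"
  have h: "(?h has_real_derivative ?k x) (at x)" for x
  proof -
    have "(?h has_real_derivative tanh x - x + 4 * tanh x ^ 3 * (1 - tanh x ^ 2) / 12) (at x)"
    proof -
      have "((\<lambda>t. ln (cosh t)) has_real_derivative tanh x) (at x)"
        by (auto intro!: derivative_eq_intros simp: cosh_real_pos tanh_def)
      moreover have "((\<lambda>t. t ^ 2 / 2) has_real_derivative x) (at x)"
        by (auto intro!: derivative_eq_intros)
      moreover have "((\<lambda>t. tanh t ^ 4 / 12) has_real_derivative
          4 * tanh x ^ 3 * (1 - tanh x ^ 2) / 12) (at x)"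
        by (auto intro!: derivative_eq_intros)
      ultimately show ?thesis
        by (intro DERIV_add DERIV_diff)
    qed
    moreover have "y - x + 4 * y ^ 3 * (1 - y ^ 2) / 12 = y + y ^ 3 / 3 - y ^ 5 / 3 - x" for y :: real
      by (simp add: field_simps flip: power_add)
    ultimately show ?thesis by (simp only:)
  qed
  have prof: "cw_profile t = exp (?h t - tanh t ^ 4 / 12)"
  proof -
    have "?h t - tanh t ^ 4 / 12 = - (t ^ 2 / 2) + ln (cosh t)"
      by simp
    then show ?thesis
      by (simp only: exp_add exp_ln cosh_real_pos cw_profile_def)
  qed
  have "?h t \<le> ?h 0"
    by (rule DERIV_nonpos_imp_nonincreasing[OF assms]) (use h tanh_taylor_bounds(1) in blast)
  then show "cw_profile t \<le> exp (- (tanh t ^ 4 / 12))"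
    by (simp add: prof)
  \<comment> \<open>Integrating 8/15 x^5 gives 4/45 t^6; the constant is afterwards rounded up to
    1.\<close>
  have "?h 0 + 4/45 * 0 ^ 6 \<le> ?h t + 4/45 * t ^ 6"
  proof (rule DERIV_nonneg_imp_nondecreasing[OF assms])
    fix x :: real assume "0 \<le> x"
    have "((\<lambda>x. ?h x + 4/45 * x ^ 6) has_real_derivative ?k x + 8/15 * x ^ 5) (at x)"
      by (rule DERIV_add[OF h]) (auto intro!: derivative_eq_intros)
    moreover have "0 \<le> ?k x + 8/15 * x ^ 5"
      using tanh_taylor_bounds(2)[OF \<open>0 \<le> x\<close>] by linarith
    ultimately show "\<exists>y. ((\<lambda>x. ?h x + 4/45 * x ^ 6) has_real_derivative y) (at x) \<and> 0 \<le> y"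
      by blast
  qed
  then have "0 \<le> ?h t + 4/45 * t ^ 6"
    by simp
  moreover have "0 \<le> t ^ 6"
    by simp
  ultimately have "- (t ^ 6) \<le> ?h t"
    by linarith
  then show "exp (- (tanh t ^ 4 / 12) - t ^ 6) \<le> cw_profile t"
    by (simp add: prof)
qed

lemma cw_profile_bounds:
  "cw_profile t \<le> exp (- (tanh t ^ 4 / 12))"
  "exp (- (tanh t ^ 4 / 12) - t ^ 6) \<le> cw_profile t"
proof -
  have "tanh \<bar>t\<bar> ^ 4 = tanh t ^ 4" "\<bar>t\<bar> ^ 6 = t ^ 6" "cw_profile \<bar>t\<bar> = cw_profile t"
    by (auto simp: abs_if cw_profile_minus)
  then show "cw_profile t \<le> exp (- (tanh t ^ 4 / 12))"
    "exp (- (tanh t ^ 4 / 12) - t ^ 6) \<le> cw_profile t"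
    using cw_profile_bounds_nonneg[of "\<bar>t\<bar>"] by auto
qed

text \<open>Writing cosh as a sum of two exponentials and completing the square makes the function a
  combination of normal densities centred at 1 and -1.\<close>

lemma integrable_cw_profile: "integrable lborel cw_profile"
proof -
  have eq: "exp (- (t ^ 2 / 2) + c * t) = exp (c ^ 2 / 2) * sqrt (2 * pi) * normal_density c 1 t"
    for t c :: real
    by (simp add: normal_density_def power2_eq_square exp_add[symmetric] field_simps)
  have int: "integrable lborel (\<lambda>t::real. exp (- (t ^ 2 / 2) + c * t))" for c
    unfolding eq by simp
  have "cw_profile t = exp (- (t ^ 2 / 2) + 1 * t) / 2 + exp (- (t ^ 2 / 2) + (-1) * t) / 2" for t
    by (simp add: cw_profile_def cosh_def exp_add[symmetric] distrib_left add_divide_distrib)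
  then have "cw_profile = (\<lambda>t. exp (- (t ^ 2 / 2) + 1 * t) / 2 + exp (- (t ^ 2 / 2) + (-1) * t) / 2)"
    by blast
  moreover have "integrable lborel (\<lambda>t::real. exp (- (t ^ 2 / 2) + 1 * t) / 2 + exp (- (t ^ 2 / 2) + (-1) * t) / 2)"
    by (intro Bochner_Integration.integrable_add integrable_divide int)
  ultimately show ?thesis by (simp only:)
qed

section \<open>The Curie-Weiss measure as a mixture\<close>

text \<open>Since \<open>cw_profile\<close> takes values in (0, 1], every power with exponent at
  least 1 is dominated by \<open>cw_profile\<close> itself.\<close>

lemma integrable_cw_profile_power:
  assumes "1 \<le> N" and [measurable]: "f \<in> borel_measurable borel" and f: "\<And>t. \<bar>f t\<bar> \<le> 1"
  shows "integrable lborel (\<lambda>t. cw_profile t ^ N * f t)"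
proof (rule Bochner_Integration.integrable_bound[OF integrable_cw_profile])
  have [measurable]: "cw_profile \<in> borel_measurable borel"
    by (intro borel_measurable_continuous_onI continuous_on_cw_profile)
  show "(\<lambda>t. cw_profile t ^ N * f t) \<in> borel_measurable lborel"
    by measurable
  have "cw_profile t ^ N * \<bar>f t\<bar> \<le> cw_profile t * 1" for t
    using power_decreasing[OF \<open>1 \<le> N\<close>, of "cw_profile t"] f[of t] cw_profile_pos[of t] cw_profile_le_1[of t]
    by (intro mult_mono) auto
  then show "AE t in lborel. norm (cw_profile t ^ N * f t) \<le> norm (cw_profile t)"
    using cw_profile_pos by (simp add: abs_mult less_imp_le)
qed

lemma spin_law_tanh_bounds:
  assumes "\<sigma> \<in> configs N"
  shows "0 \<le> spin_law N (tanh t) \<sigma>" and "spin_law N (tanh t) \<sigma> \<le> 1"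
proof -
  have "\<bar>tanh t\<bar> \<le> 1"
    using tanh_real_bounds[of t] by (auto simp: abs_le_iff)
  from spin_law_unit_interval[OF assms this]
  show "0 \<le> spin_law N (tanh t) \<sigma>" "spin_law N (tanh t) \<sigma> \<le> 1"
    by auto
qed

lemma borel_measurable_spin_law [measurable]: "(\<lambda>m. spin_law N m \<sigma>) \<in> borel_measurable borel"
  by (intro borel_measurable_continuous_onI continuous_on_spin_law)

lemma borel_measurable_tanh [measurable]: "(tanh :: real \<Rightarrow> real) \<in> borel_measurable borel"
  by (intro borel_measurable_continuous_onI continuous_on_tanh continuous_on_id) (auto simp: cosh_real_pos less_imp_neq[symmetric])

text \<open>Hubbard-Stratonovich transformation: with S the total spin, completing the square shows
  that the integrand is a constant multiple of the normal density with mean S/N and variance 1/N,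
  whose integral is 1.\<close>

lemma cw_weight_eq_mixture:
  assumes "1 \<le> N" and \<sigma>: "\<sigma> \<in> configs N"
  shows "cw_weight N \<sigma> = 2 ^ N * sqrt (real N / (2 * pi)) *
    (LINT t|lborel. cw_profile t ^ N * spin_law N (tanh t) \<sigma>)"
proof -
  define S where "S = (\<Sum>i\<in>{1..N}. \<sigma> i)"
  have n: "0 < real N" using assms by simp
  have w: "cw_weight N \<sigma> = exp (S\<^sup>2 / (2 * real N))"
    by (simp add: cw_weight_def S_def power2_eq_square sum_product)
  have "cw_profile t ^ N * spin_law N (tanh t) \<sigma> =
      cw_weight N \<sigma> * sqrt (2 * pi / real N) / 2 ^ N * normal_density (S / N) (1 / sqrt N) t" for t
  proof -
    have "normal_density (S / N) (1 / sqrt N) t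
        = sqrt (real N / (2 * pi)) * exp (- (real N * (t - S / N)\<^sup>2 / 2))"
      using n by (simp add: normal_density_def power_divide real_sqrt_divide real_sqrt_mult)
    then have "cw_weight N \<sigma> * sqrt (2 * pi / real N) * normal_density (S / N) (1 / sqrt N) t =
        (sqrt (2 * pi / real N) * sqrt (real N / (2 * pi))) *
        (exp (S\<^sup>2 / (2 * real N)) * exp (- (real N * (t - S / N)\<^sup>2 / 2)))"
      by (simp add: w)
    also have "sqrt (2 * pi / real N) * sqrt (real N / (2 * pi)) = 1"
      using n by (simp flip: real_sqrt_mult)
    also have "exp (S\<^sup>2 / (2 * real N)) * exp (- (real N * (t - S / N)\<^sup>2 / 2))
        = exp (S\<^sup>2 / (2 * real N) - real N * (t - S / N)\<^sup>2 / 2)"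
      by (simp only: exp_add[symmetric] diff_conv_add_uminus)
    also have "S\<^sup>2 / (2 * real N) - real N * (t - S / N)\<^sup>2 / 2 = real N * - (t\<^sup>2 / 2) + t * S"
      using n by (simp add: power2_eq_square field_simps)
    also have "exp (real N * - (t\<^sup>2 / 2) + t * S) = exp (- (t\<^sup>2 / 2)) ^ N * exp (t * S)"
      by (simp only: exp_add exp_of_nat_mult)
    also have "exp (t * S) = 2 ^ N * cosh t ^ N * spin_law N (tanh t) \<sigma>"
      using spin_law_tanh[OF \<sigma>] by (simp add: S_def)
    finally show ?thesis
      by (simp add: cw_profile_def power_mult_distrib)
  qed
  then have "(LINT t|lborel. cw_profile t ^ N * spin_law N (tanh t) \<sigma>)
      = cw_weight N \<sigma> * sqrt (2 * pi / real N) / 2 ^ N"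
    using n by simp
  moreover have "sqrt (real N / (2 * pi)) * sqrt (2 * pi / real N) = 1"
    using n by (simp flip: real_sqrt_mult)
  ultimately show ?thesis
    by (simp add: mult.assoc mult.left_commute)
qed

definition cw_mass :: "nat \<Rightarrow> real" where
  "cw_mass N = (LINT t|lborel. cw_profile t ^ N)"

text \<open>Sum and integral are exchanged and each spin law has total mass 1. With \<open>f\<close>
  constant this yields the partition function, and with \<open>f\<close> a tail indicator the total
  mass of the tail mixture.\<close>

lemma integral_spin_law_sum:
  assumes "1 \<le> N" and [measurable]: "f \<in> borel_measurable borel" and f: "\<And>t. \<bar>f t\<bar> \<le> 1"
  shows "(\<Sum>\<sigma>\<in>configs N. (LINT t|lborel. cw_profile t ^ N * (f t * spin_law N (tanh t) \<sigma>)))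
    = (LINT t|lborel. cw_profile t ^ N * f t)"
proof -
  have "integrable lborel (\<lambda>t. cw_profile t ^ N * (f t * spin_law N (tanh t) \<sigma>))"
    if "\<sigma> \<in> configs N" for \<sigma>
    using spin_law_tanh_bounds[OF that] f assms(1)
    by (intro integrable_cw_profile_power) (auto simp: abs_mult mult_le_one)
  then have "(\<Sum>\<sigma>\<in>configs N. (LINT t|lborel. cw_profile t ^ N * (f t * spin_law N (tanh t) \<sigma>)))
      = (LINT t|lborel. (\<Sum>\<sigma>\<in>configs N. cw_profile t ^ N * (f t * spin_law N (tanh t) \<sigma>)))"
    by (rule Bochner_Integration.integral_sum[symmetric])
  then show ?thesis
    by (simp add: sum_spin_law flip: sum_distrib_left)
qed

lemma cw_Z_eq:
  assumes "1 \<le> N"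
  shows "cw_Z N = 2 ^ N * sqrt (real N / (2 * pi)) * cw_mass N"
  using integral_spin_law_sum[OF assms, of "\<lambda>_. 1"]
  by (simp add: cw_Z_def cw_mass_def cw_weight_eq_mixture[OF assms] flip: sum_distrib_left)

lemma cw_Z_pos: "0 < cw_Z N"
proof -
  have "(\<lambda>i\<in>{1..N}. 1) \<in> configs N"
    by (auto simp: configs_def)
  then show ?thesis
    unfolding cw_Z_def by (intro sum_pos finite_configs) (auto simp: cw_weight_def)
qed

lemma cw_mass_pos: "1 \<le> N \<Longrightarrow> 0 < cw_mass N"
proof -
  assume "1 \<le> N"
  then have "0 < 2 ^ N * sqrt (real N / (2 * pi)) * cw_mass N"
    using cw_Z_pos[of N] cw_Z_eq[of N] by metis
  then show "0 < cw_mass N"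
    by (rule zero_less_mult_pos) (use \<open>1 \<le> N\<close> in simp)
qed

lemma cw_mass_le:
  assumes "1 \<le> N"
  shows "cw_mass N \<le> cw_mass 1"
  unfolding cw_mass_def
proof (rule integral_mono)
  show "integrable lborel (\<lambda>t. cw_profile t ^ N)" "integrable lborel (\<lambda>t. cw_profile t ^ 1)"
    using integrable_cw_profile_power[of _ "\<lambda>_. 1"] integrable_cw_profile assms by auto
  show "cw_profile t ^ N \<le> cw_profile t ^ 1" for t
    using assms cw_profile_pos[of t] cw_profile_le_1[of t] by (intro power_decreasing) auto
qed

text \<open>One factor \<open>cw_profile t\<close> is kept to ensure integrability; the other N - 1
  factors are bounded by monotonicity through the value at a. This explains the exponent N -
  1.\<close>

lemma cw_tail_le:
  assumes "1 \<le> N" "0 \<le> a"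
  shows "(LINT t|lborel. cw_profile t ^ N * indicator (- {-a..a}) t)
    \<le> cw_mass 1 * exp (- (real (N - 1) * tanh a ^ 4 / 12))"
proof -
  let ?e = "exp (- (real (N - 1) * tanh a ^ 4 / 12))"
  have "(LINT t|lborel. cw_profile t ^ N * indicator (- {-a..a}) t)
      \<le> (LINT t|lborel. cw_profile t * ?e)"
  proof (rule integral_mono)
    show "integrable lborel (\<lambda>t. cw_profile t ^ N * indicator (- {-a..a}) t)"
      using assms by (intro integrable_cw_profile_power) (auto simp: indicator_def)
    show "integrable lborel (\<lambda>t. cw_profile t * ?e)"
      by (intro integrable_mult_left integrable_cw_profile)
    fix t
    show "cw_profile t ^ N * indicator (- {-a..a}) t \<le> cw_profile t * ?e"
    proof (cases "t \<in> {-a..a}")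
      case False
      have "cw_profile t = cw_profile \<bar>t\<bar>"
        by (simp add: abs_if cw_profile_minus)
      also have "\<dots> \<le> cw_profile a"
        using False assms by (intro cw_profile_antimono) auto
      also have "\<dots> \<le> exp (- (tanh a ^ 4 / 12))"
        by (rule cw_profile_bounds)
      finally have "cw_profile t ^ (N - 1) \<le> exp (- (tanh a ^ 4 / 12)) ^ (N - 1)"
        using cw_profile_pos[of t] by (intro power_mono) auto
      also have "\<dots> = ?e"
        by (simp flip: exp_of_nat_mult)
      finally have "cw_profile t * cw_profile t ^ (N - 1) \<le> cw_profile t * ?e"
        using cw_profile_pos[of t] by (intro mult_left_mono) auto
      then show ?thesis
        using False assms by (simp flip: power_Suc)
    qed (simp add: cw_profile_pos less_imp_le)
  qed
  then show ?thesis by (simp add: cw_mass_def)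
qed

section \<open>The quartic density and its tail mass\<close>

definition quartic_Z :: real where
  "quartic_Z = (LINT y|lborel. exp (- (1/12) * y ^ 4))"

text \<open>Comparison with a Gaussian: expanding (y^2 - 6)^2 \<ge> 0 gives y^4/24 \<ge> y^2/2 -
  3/2. The coefficient 1/24 is half of 1/12, which is what the tail estimate leaves over.\<close>

lemma integrable_exp_quartic: "integrable lborel (\<lambda>y::real. exp (- (1/24) * y ^ 4))"
proof (rule Bochner_Integration.integrable_bound)
  show "integrable lborel (\<lambda>y. exp (3/2) * sqrt (2 * pi) * std_normal_density y)"
    by simp
  have "exp (- (1/24) * y ^ 4) \<le> exp (3/2 + - y\<^sup>2 / 2)" for y :: real
  proof -
    have "0 \<le> (y\<^sup>2 - 6)\<^sup>2" by simp
    also have "\<dots> = y ^ 4 - 12 * y\<^sup>2 + 36"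
      by (simp add: power2_eq_square algebra_simps eval_nat_numeral)
    finally show ?thesis by simp
  qed
  then have "exp (- (1/24) * y ^ 4) \<le> exp (3/2) * exp (- y\<^sup>2 / 2)" for y :: real
    by (simp only: exp_add)
  then show "AE y in lborel. norm (exp (- (1/24) * y ^ 4))
      \<le> norm (exp (3/2) * sqrt (2 * pi) * std_normal_density y)"
    by (simp add: std_normal_density_def)
qed simp

lemma integrable_exp_quartic_12: "integrable lborel (\<lambda>y::real. exp (- (1/12) * y ^ 4))"
  by (rule Bochner_Integration.integrable_bound[OF integrable_exp_quartic]) auto

lemma quartic_Z_pos: "0 < quartic_Z"
proof -
  have "(LINT y|lborel. exp (- (1/12)) * indicator {0..1::real} y) \<le> quartic_Z"
    unfolding quartic_Z_def
  proof (rule integral_mono[OF _ integrable_exp_quartic_12])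
    show "exp (- (1/12)) * indicator {0..1} y \<le> exp (- (1/12) * y ^ 4)" for y :: real
      using power_le_one[of y 4] by (auto simp: indicator_def)
  qed auto
  moreover have "(LINT y|lborel. exp (- (1/12)) * indicator {0..1::real} y) = exp (- (1/12) :: real)"
    by simp
  ultimately show ?thesis
    using exp_gt_zero[of "- (1/12) :: real"] by linarith
qed

lemma quartic_density_eq: "quartic_density y = exp (- (1/12) * y ^ 4) / quartic_Z"
  by (simp add: quartic_density_def quartic_Z_def)

lemma quartic_density_nonneg: "0 \<le> quartic_density y"
  using quartic_Z_pos by (simp add: quartic_density_eq)

lemma borel_measurable_quartic_density [measurable]: "quartic_density \<in> borel_measurable borel"
  unfolding quartic_density_eq [abs_def] by measurable

lemma integrable_quartic_density: "integrable lborel quartic_density"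
  unfolding quartic_density_eq [abs_def] by (intro integrable_divide integrable_exp_quartic_12)

lemma integral_quartic_density: "(LINT y|lborel. quartic_density y) = 1"
  using quartic_Z_pos by (simp add: quartic_density_eq [abs_def] quartic_Z_def)

lemma integrable_quartic_density_mult:
  assumes [measurable]: "f \<in> borel_measurable borel" and f: "\<And>t. \<bar>f t\<bar> \<le> 1"
  shows "integrable lborel (\<lambda>t. quartic_density t * f t)"
proof (rule Bochner_Integration.integrable_bound[OF integrable_quartic_density])
  show "AE t in lborel. norm (quartic_density t * f t) \<le> norm (quartic_density t)"
    using f by (simp add: abs_mult mult_left_le)
qed simp

definition quartic_tail :: "real \<Rightarrow> real" where
  "quartic_tail L = (LINT y|lborel. quartic_density y * indicator (- {-L..L}) y)"

lemma quartic_tail_nonneg: "0 \<le> quartic_tail L"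
  unfolding quartic_tail_def by (intro integral_nonneg_AE) (simp add: quartic_density_nonneg)

text \<open>The exponent y^4/12 is split into equal halves: outside the interval one half is at
  least L^4/24, and the other remains integrable.\<close>

lemma quartic_tail_le:
  assumes "0 \<le> L"
  shows "quartic_tail L \<le> (LINT y|lborel. exp (- (1/24) * y ^ 4)) / quartic_Z * exp (- (L ^ 4 / 24))"
proof -
  have "quartic_tail L \<le> (LINT y|lborel. exp (- (1/24) * y ^ 4) * (exp (- (L ^ 4 / 24)) / quartic_Z))"
    unfolding quartic_tail_def
  proof (rule integral_mono)
    show "integrable lborel (\<lambda>y. quartic_density y * indicator (- {-L..L}) y)"
      by (intro integrable_quartic_density_mult) (auto simp: indicator_def)
    show "integrable lborel (\<lambda>y. exp (- (1/24) * y ^ 4) * (exp (- (L ^ 4 / 24)) / quartic_Z))"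
      by (intro integrable_mult_left integrable_exp_quartic)
    fix y
    show "quartic_density y * indicator (- {-L..L}) y
        \<le> exp (- (1/24) * y ^ 4) * (exp (- (L ^ 4 / 24)) / quartic_Z)"
    proof (cases "y \<in> {-L..L}")
      case False
      have "L ^ 4 \<le> \<bar>y\<bar> ^ 4"
        using False assms by (intro power_mono) auto
      then have "exp (- (1/12) * y ^ 4) \<le> exp (- (1/24) * y ^ 4 + - (L ^ 4 / 24))"
        by simp
      then have "exp (- (1/12) * y ^ 4) \<le> exp (- (1/24) * y ^ 4) * exp (- (L ^ 4 / 24))"
        by (simp only: exp_add)
      then show ?thesis
        using False quartic_Z_pos by (simp add: quartic_density_eq divide_right_mono)
    qed (use quartic_Z_pos in simp)
  qed
  then show ?thesis by simp
qed

section \<open>The truncated quartic mixture\<close>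

text \<open>Change of variables y = c tanh t, with Jacobian c (1 - tanh^2 t). The function F is left
  general so that it can be a spin law as well as the constant 1.\<close>

lemma quartic_substitution:
  fixes F :: "real \<Rightarrow> real"
  assumes "0 < c" "0 \<le> a" and F: "continuous_on UNIV F"
  shows "(LINT y|lborel. quartic_density y * F (y / c) * indicator {- (c * tanh a)..c * tanh a} y)
    = (LINT t|lborel. quartic_density (c * tanh t) * F (tanh t) * (c * (1 - tanh t ^ 2)) * indicator {-a..a} t)"
    (is ?eq)
  and "set_integrable lborel {-a..a}
    (\<lambda>t. quartic_density (c * tanh t) * F (tanh t) * (c * (1 - tanh t ^ 2)))" (is ?int)
proof -
  let ?g = "\<lambda>t. c * tanh t" and ?f = "\<lambda>y. quartic_density y * F (y / c)"
  have "continuous_on {?g (- a)..?g a} ?f"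
    unfolding quartic_density_eq using \<open>0 < c\<close> quartic_Z_pos
    by (intro continuous_intros continuous_on_compose2[OF F]) auto
  then have 1: "set_integrable lborel {?g (- a)..?g a} ?f"
    by (intro borel_integrable_atLeastAtMost')
  have 2: "(?g has_real_derivative c * (1 - tanh t ^ 2)) (at t)" for t
    by (auto intro!: derivative_eq_intros)
  have 3: "continuous_on {-a..a} (\<lambda>t. c * (1 - tanh t ^ 2))"
    by (intro continuous_intros) auto
  have 4: "0 \<le> c * (1 - tanh t ^ 2)" for t
    using tanh_real_bounds[of t] \<open>0 < c\<close> by (simp add: abs_square_le_1 abs_le_iff)
  note * = integral_substitution[of "?g" "-a" a, OF 1 2 3 4]
  show ?eq ?int
    using * assms by auto
qed

lemma tanh_bounds_on_interval:
  assumes "t \<in> {-a..a}"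
  shows "\<bar>tanh t\<bar> \<le> tanh (a::real)" and "tanh t ^ 2 \<le> tanh a ^ 2"
proof -
  have "tanh (-a) \<le> tanh t" "tanh t \<le> tanh a"
    using assms by (simp_all only: tanh_real_le_iff atLeastAtMost_iff)
  then show 1: "\<bar>tanh t\<bar> \<le> tanh a"
    unfolding tanh_minus by linarith
  then show "tanh t ^ 2 \<le> tanh a ^ 2"
    by (rule abs_le_square_iff[THEN iffD1, OF order_trans, OF _ abs_ge_self])
qed

definition main_part :: "nat \<Rightarrow> real \<Rightarrow> (real \<Rightarrow> real) \<Rightarrow> real" where
  "main_part N a F = (LINT t|lborel. cw_profile t ^ N * F (tanh t) * indicator {-a..a} t)"

text \<open>For c^4 = N the quartic density at c tanh t is exp (-tanh^4 t / 12)^N up to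
  normalization, which \<open>cw_profile_bounds\<close> compares with
  \<open>cw_profile t ^ N\<close>. The Jacobian lies between c (1 - tanh^2 a) and c. The comparison
  is pointwise in t, so it passes to the integral against any F that is nonnegative on
  [-1, 1].\<close>

lemma quartic_main_part_bounds:
  fixes F :: "real \<Rightarrow> real"
  assumes "1 \<le> N" "0 \<le> a" and F: "continuous_on UNIV F" "\<And>m. \<bar>m\<bar> \<le> 1 \<Longrightarrow> 0 \<le> F m"
    and c: "0 < c" "c ^ 4 = real N"
  defines "V \<equiv> LINT y|lborel. quartic_density y * F (y / c) * indicator {- (c * tanh a)..c * tanh a} y"
  shows "c / quartic_Z * (1 - tanh a ^ 2) * main_part N a F \<le> V"
    and "V \<le> c / quartic_Z * exp (real N * a ^ 6) * main_part N a F"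
proof -
  let ?\<kappa> = "c / quartic_Z"
  have \<kappa>: "0 < ?\<kappa>" using c quartic_Z_pos by simp
  let ?v = "\<lambda>t. quartic_density (c * tanh t) * F (tanh t) * (c * (1 - tanh t ^ 2))"
  let ?w = "\<lambda>t. cw_profile t ^ N * F (tanh t)"
  have V: "V = (LINT t|lborel. ?v t * indicator {-a..a} t)"
    unfolding V_def using quartic_substitution(1)[OF c(1) assms(2) F(1)] by simp
  have int_v: "integrable lborel (\<lambda>t. ?v t * indicator {-a..a} t)"
    using quartic_substitution(2)[OF c(1) assms(2) F(1)]
    by (simp add: set_integrable_def mult.commute)
  have "continuous_on {-a..a} ?w"
    by (intro continuous_intros continuous_on_cw_profile continuous_on_compose2[OF F(1)]) auto
  then have int_w: "integrable lborel (\<lambda>t. ?w t * indicator {-a..a} t)"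
    using borel_integrable_atLeastAtMost'[of "-a" a ?w] by (simp add: set_integrable_def mult.commute)
  have pointwise: "?\<kappa> * (1 - tanh a ^ 2) * ?w t \<le> ?v t" "?v t \<le> ?\<kappa> * exp (real N * a ^ 6) * ?w t"
    if t: "t \<in> {-a..a}" for t
  proof -
    have F0: "0 \<le> F (tanh t)"
      using tanh_real_bounds[of t] by (intro F(2)) (simp add: abs_le_iff)
    have s: "tanh t ^ 2 \<le> tanh a ^ 2" "tanh a ^ 2 \<le> 1"
      using tanh_bounds_on_interval[OF t] tanh_real_bounds[of a] by (auto simp: abs_square_le_1 abs_le_iff)
    define e where "e = exp (- (tanh t ^ 4 / 12))"
    have eN: "e ^ N = exp (- (real N * tanh t ^ 4 / 12))"
      by (simp add: e_def flip: exp_of_nat_mult)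
    have v: "?v t = ?\<kappa> * (e ^ N * (1 - tanh t ^ 2) * F (tanh t))"
      by (simp add: quartic_density_eq eN power_mult_distrib c)
    have low: "cw_profile t ^ N \<le> e ^ N"
      unfolding e_def using cw_profile_pos[of t] by (intro power_mono cw_profile_bounds) simp
    have "t ^ 6 \<le> a ^ 6"
      using t power_mono[of "\<bar>t\<bar>" a 6] by (simp add: power_even_abs abs_le_iff)
    \<comment> \<open>Replacing the error t^6 by a^6 makes it uniform on the interval; its N-th
      power is the factor exp (N a^6).\<close>
    then have "e \<le> exp (- (tanh t ^ 4 / 12) - t ^ 6 + a ^ 6)"
      by (simp add: e_def)
    also have "\<dots> \<le> cw_profile t * exp (a ^ 6)"
      using cw_profile_bounds(2)[of t] by (simp add: exp_add)
    finally have "e ^ N \<le> (cw_profile t * exp (a ^ 6)) ^ N"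
      by (intro power_mono) (auto simp: e_def)
    also have "\<dots> = cw_profile t ^ N * exp (real N * a ^ 6)"
      by (simp only: power_mult_distrib exp_of_nat_mult)
    finally have up: "e ^ N \<le> cw_profile t ^ N * exp (real N * a ^ 6)" .
    have "cw_profile t ^ N * (1 - tanh a ^ 2) \<le> e ^ N * (1 - tanh t ^ 2)"
      using low s by (intro mult_mono) (auto simp: e_def)
    then have "?\<kappa> * (cw_profile t ^ N * (1 - tanh a ^ 2) * F (tanh t)) \<le> ?v t"
      unfolding v using F0 \<kappa> by (intro mult_left_mono mult_right_mono) auto
    then show "?\<kappa> * (1 - tanh a ^ 2) * ?w t \<le> ?v t"
      by (simp add: mult_ac)
    have "e ^ N * (1 - tanh t ^ 2) \<le> cw_profile t ^ N * exp (real N * a ^ 6) * 1"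
      using up s by (intro mult_mono) (auto simp: e_def less_imp_le[OF cw_profile_pos])
    then have "?v t \<le> ?\<kappa> * (cw_profile t ^ N * exp (real N * a ^ 6) * 1 * F (tanh t))"
      unfolding v using F0 \<kappa> by (intro mult_left_mono mult_right_mono) auto
    then show "?v t \<le> ?\<kappa> * exp (real N * a ^ 6) * ?w t"
      by (simp add: mult_ac)
  qed
  have "?\<kappa> * (1 - tanh a ^ 2) * main_part N a F =
      (LINT t|lborel. ?\<kappa> * (1 - tanh a ^ 2) * (?w t * indicator {-a..a} t))"
    unfolding main_part_def by (rule integral_mult_right_zero[symmetric])
  also have "\<dots> \<le> V"
    unfolding V using int_w int_v pointwise
    by (intro integral_mono integrable_mult_right) (auto simp: indicator_def)
  finally show "?\<kappa> * (1 - tanh a ^ 2) * main_part N a F \<le> V" .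
  have "V \<le> (LINT t|lborel. ?\<kappa> * exp (real N * a ^ 6) * (?w t * indicator {-a..a} t))"
    unfolding V using int_w int_v pointwise
    by (intro integral_mono integrable_mult_right) (auto simp: indicator_def)
  also have "\<dots> = ?\<kappa> * exp (real N * a ^ 6) * main_part N a F"
    unfolding main_part_def by (rule integral_mult_right_zero)
  finally show "V \<le> ?\<kappa> * exp (real N * a ^ 6) * main_part N a F" .
qed

text \<open>The truncated variable is 0 wherever \<xi> leaves [-L, L], and mean 0 is the uniform
  law. The truncation therefore contributes an atom of mass \<open>quartic_tail L\<close> with
  weight 2^-N on each configuration.\<close>

lemma mix_weight_eq:
  fixes M :: "'w measure" and \<xi> :: "'w \<Rightarrow> real"
  assumes dist: "distributed M lborel \<xi> (\<lambda>x. ennreal (quartic_density x))"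
    and "1 \<le> N" and \<sigma>: "\<sigma> \<in> configs N" and L: "L = real N powr \<delta>" "L \<le> root 4 (real N)"
  shows "mix_weight M (trunc_rv \<xi> \<delta> N) N \<sigma> =
    (LINT y|lborel. quartic_density y * spin_law N (y / root 4 (real N)) \<sigma> * indicator {-L..L} y)
    + quartic_tail L * (1/2) ^ N"
proof -
  let ?c = "root 4 (real N)"
  have c: "0 < ?c" using assms by simp
  have L0: "0 \<le> L" using L by simp
  define g where "g y = spin_law N (y * indicator {-L..L} y / ?c) \<sigma>" for y
  have [measurable]: "g \<in> borel_measurable borel"
    unfolding g_def by measurable
  have "mix_weight M (trunc_rv \<xi> \<delta> N) N \<sigma> = (LINT \<omega>|M. g (\<xi> \<omega>))"
    unfolding mix_weight_def trunc_rv_def g_def spin_law_def L(1)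
    by (intro Bochner_Integration.integral_cong prod.cong refl) (auto simp: indicator_def abs_le_iff)
  also have "\<dots> = (LINT y|lborel. quartic_density y * g y)"
    by (rule distributed_integral[OF dist, symmetric]) (auto simp: quartic_density_nonneg)
  also have "\<dots> = (LINT y|lborel. quartic_density y * (spin_law N (y / ?c) \<sigma> * indicator {-L..L} y)
      + quartic_density y * indicator (- {-L..L}) y * (1/2) ^ N)"
    by (intro Bochner_Integration.integral_cong refl) (auto simp: g_def indicator_def spin_law_0)
  also have "\<dots> = (LINT y|lborel. quartic_density y * (spin_law N (y / ?c) \<sigma> * indicator {-L..L} y))
      + (LINT y|lborel. quartic_density y * indicator (- {-L..L}) y * (1/2) ^ N)"
  proof (rule Bochner_Integration.integral_add)
    \<comment> \<open>Outside the interval the mean y / c may leave [-1, 1], so the indicator stays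
      attached to the spin law when it is bounded by 1.\<close>
    have "\<bar>spin_law N (y / ?c) \<sigma> * indicator {-L..L} y\<bar> \<le> 1" for y
    proof (cases "y \<in> {-L..L}")
      case True
      then have "\<bar>y / ?c\<bar> \<le> 1"
        using L(2) c by (auto simp: abs_le_iff pos_divide_le_eq pos_le_divide_eq)
      from spin_law_unit_interval(3)[OF \<sigma> this] show ?thesis
        using True by simp
    qed simp
    then show "integrable lborel (\<lambda>y. quartic_density y * (spin_law N (y / ?c) \<sigma> * indicator {-L..L} y))"
      by (intro integrable_quartic_density_mult) auto
    show "integrable lborel (\<lambda>y. quartic_density y * indicator (- {-L..L}) y * (1/2) ^ N)"
      by (intro integrable_mult_left integrable_quartic_density_mult) (auto simp: indicator_def)
  qed
  also have "(LINT y|lborel. quartic_density y * indicator (- {-L..L}) y * (1/2) ^ N)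
      = quartic_tail L * (1/2) ^ N"
    unfolding quartic_tail_def by (rule integral_mult_left_zero)
  finally show ?thesis
    by (simp only: mult.assoc)
qed

lemma quartic_density_interval:
  "(LINT y|lborel. quartic_density y * indicator {-L..L} y) = 1 - quartic_tail L"
proof -
  have "1 = (LINT y|lborel. quartic_density y * indicator {-L..L} y + quartic_density y * indicator (- {-L..L}) y)"
    unfolding integral_quartic_density[symmetric]
    by (intro Bochner_Integration.integral_cong) (auto simp: indicator_def)
  also have "\<dots> = (LINT y|lborel. quartic_density y * indicator {-L..L} y) + quartic_tail L"
    unfolding quartic_tail_def
    by (intro Bochner_Integration.integral_add integrable_quartic_density_mult) (auto simp: indicator_def)
  finally show ?thesis by simp
qed

section \<open>Comparison of the two mixtures\<close>

lemma tanh_artanh_real: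
  fixes s :: real
  assumes "\<bar>s\<bar> < 1"
  shows "tanh (artanh s) = s"
proof -
  define q where "q = (1 + s) / (1 - s)"
  have s: "0 < 1 - s" "0 < 1 + s"
    using assms by auto
  then have q: "0 < q"
    by (simp add: q_def)
  have "artanh s = ln (sqrt q)"
    using q by (simp add: artanh_def q_def[symmetric] ln_sqrt)
  then have "tanh (artanh s) = (q - 1) / (q + 1)"
    using q tanh_ln_real[of "sqrt q"] by simp
  moreover have "q - 1 = 2 * s / (1 - s)" "q + 1 = 2 / (1 - s)"
    using s by (simp_all add: q_def field_simps)
  ultimately show ?thesis
    using s by simp
qed

text \<open>The derivative of 2 tanh x - x is 1 - 2 tanh^2 x, which is positive as long as tanh x
  \<le> 1/2. This turns powers of the cutoff a into powers of tanh a.\<close>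

lemma le_double_tanh:
  assumes "0 \<le> a" "tanh a \<le> 1/2"
  shows "a \<le> 2 * tanh (a::real)"
proof -
  have "2 * tanh 0 - 0 \<le> 2 * tanh a - a"
  proof (rule DERIV_nonneg_imp_nondecreasing[OF assms(1)])
    fix x assume x: "0 \<le> x" "x \<le> a"
    have "tanh x \<le> 1/2"
      using x assms(2) tanh_real_le_iff[of x a] by linarith
    then have "tanh x ^ 2 \<le> (1/2) ^ 2"
      using x by (intro power_mono) auto
    then have "0 \<le> 2 * (1 - tanh x ^ 2) - 1"
      by (simp add: power2_eq_square)
    moreover have "((\<lambda>x. 2 * tanh x - x) has_real_derivative 2 * (1 - tanh x ^ 2) - 1) (at x)"
      by (auto intro!: derivative_eq_intros)
    ultimately show "\<exists>y. ((\<lambda>x. 2 * tanh x - x) has_real_derivative y) (at x) \<and> 0 \<le> y"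
      by blast
  qed
  then show ?thesis by simp
qed

definition cw_tail :: "nat \<Rightarrow> real \<Rightarrow> real" where
  "cw_tail N a = (LINT t|lborel. cw_profile t ^ N * indicator (- {-a..a}) t)"

lemma cw_tail_nonneg: "0 \<le> cw_tail N a"
  unfolding cw_tail_def using cw_profile_pos by (intro integral_nonneg_AE) (simp add: less_imp_le)

text \<open>The constant by which the two mixing densities differ on the t-axis: the factor N^(1/4)
  of the Jacobian over the quartic normalization.\<close>

definition quartic_scale :: "nat \<Rightarrow> real" where
  "quartic_scale N = root 4 (real N) / quartic_Z"

text \<open>A fixed N, with a chosen so that |t| \<le> a corresponds to |y| \<le> N^\<delta> under y
  = N^(1/4) tanh t. The bound tanh a \<le> 1/2 keeps all means of the mixture away from 1 and
  -1.\<close>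

locale cw_mixture_comparison =
  fixes M :: "'w measure" and \<xi> :: "'w \<Rightarrow> real" and \<delta> a :: real and N :: nat
  assumes dist: "distributed M lborel \<xi> (\<lambda>x. ennreal (quartic_density x))"
    and N: "1 \<le> N" and a: "0 \<le> a" "tanh a \<le> 1/2"
    and trunc: "root 4 (real N) * tanh a = real N powr \<delta>"
begin

abbreviation "\<kappa> \<equiv> quartic_scale N"
abbreviation "low \<equiv> 1 - tanh a ^ 2"
abbreviation "up \<equiv> exp (real N * a ^ 6)"
abbreviation "p \<equiv> quartic_tail (real N powr \<delta>)"
abbreviation "\<mu> \<sigma> \<equiv> cw_weight N \<sigma> / cw_Z N"
abbreviation "\<nu> \<sigma> \<equiv> mix_weight M (trunc_rv \<xi> \<delta> N) N \<sigma>"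
abbreviation "main \<sigma> \<equiv> main_part N a (\<lambda>m. spin_law N m \<sigma>)"
abbreviation "rest \<sigma> \<equiv>
  (LINT t|lborel. cw_profile t ^ N * (indicator (- {-a..a}) t * spin_law N (tanh t) \<sigma>))"

lemma root_pos: "0 < root 4 (real N)" and root4: "root 4 (real N) ^ 4 = real N"
  using N by auto

lemma \<kappa>_pos: "0 < \<kappa>"
  using root_pos quartic_Z_pos by (simp add: quartic_scale_def)

lemma \<kappa>_up_pos: "0 < \<kappa> * up"
  using \<kappa>_pos by simp

lemma low_pos: "0 < low"
  using power_mono[of "tanh a" "1/2" 2] a by (simp add: power2_eq_square)

lemma cutoff_le_root: "real N powr \<delta> \<le> root 4 (real N) * (1/2)"
  unfolding trunc[symmetric] using a root_pos by (intro mult_left_mono) auto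

lemma mix_weight_split:
  assumes "\<sigma> \<in> configs N"
  shows "\<nu> \<sigma> = (LINT y|lborel. quartic_density y * spin_law N (y / root 4 (real N)) \<sigma> *
      indicator {- (real N powr \<delta>)..real N powr \<delta>} y) + p * (1/2) ^ N"
proof (rule mix_weight_eq[OF dist N assms refl])
  show "real N powr \<delta> \<le> root 4 (real N)"
    using cutoff_le_root root_pos by linarith
qed

lemma mix_weight_bounds:
  assumes "\<sigma> \<in> configs N"
  shows "\<kappa> * low * main \<sigma> + p * (1/2) ^ N \<le> \<nu> \<sigma>"
    and "\<nu> \<sigma> \<le> \<kappa> * up * main \<sigma> + p * (1/2) ^ N"
  using quartic_main_part_bounds[OF N a(1) continuous_on_spin_law _ root_pos root4, of N \<sigma>]
    spin_law_unit_interval(1)[OF assms]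
  unfolding mix_weight_split[OF assms] trunc quartic_scale_def
  by auto

lemma main_part_1: "main_part N a (\<lambda>_. 1) = cw_mass N - cw_tail N a"
proof -
  have "cw_mass N = (LINT t|lborel. cw_profile t ^ N * indicator {-a..a} t
      + cw_profile t ^ N * indicator (- {-a..a}) t)"
    unfolding cw_mass_def by (intro Bochner_Integration.integral_cong) (auto simp: indicator_def)
  also have "\<dots> = main_part N a (\<lambda>_. 1) + cw_tail N a"
    unfolding main_part_def cw_tail_def mult_1_right
    by (intro Bochner_Integration.integral_add integrable_cw_profile_power N) (auto simp: indicator_def)
  finally show ?thesis by simp
qed

text \<open>The same comparison as for the weights, with F = 1. It pins
  \<open>\<kappa> * cw_mass N\<close> near 1, so no separate asymptotic evaluation of
  \<open>cw_mass N\<close> is required.\<close>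

lemma mass_bounds:
  shows "\<kappa> * low * (cw_mass N - cw_tail N a) \<le> 1 - p"
    and "1 - p \<le> \<kappa> * up * (cw_mass N - cw_tail N a)"
  using quartic_main_part_bounds[OF N a(1) continuous_on_const _ root_pos root4, of 1]
  unfolding trunc main_part_1 quartic_scale_def by (simp_all add: quartic_density_interval)

lemma cw_weight_split:
  assumes "\<sigma> \<in> configs N"
  shows "\<mu> \<sigma> = main \<sigma> / cw_mass N + rest \<sigma> / cw_mass N"
proof -
  have "(LINT t|lborel. cw_profile t ^ N * spin_law N (tanh t) \<sigma>) =
     (LINT t|lborel. cw_profile t ^ N * (spin_law N (tanh t) \<sigma> * indicator {-a..a} t) +
      cw_profile t ^ N * (indicator (- {-a..a}) t * spin_law N (tanh t) \<sigma>))"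
    by (intro Bochner_Integration.integral_cong) (auto simp: indicator_def)
  also have "\<dots> = (LINT t|lborel. cw_profile t ^ N * (spin_law N (tanh t) \<sigma> * indicator {-a..a} t)) + rest \<sigma>"
    using spin_law_tanh_bounds[OF assms]
    by (intro Bochner_Integration.integral_add integrable_cw_profile_power N) (auto simp: indicator_def)
  finally have "(LINT t|lborel. cw_profile t ^ N * spin_law N (tanh t) \<sigma>) = main \<sigma> + rest \<sigma>"
    by (simp add: main_part_def mult.assoc)
  then show ?thesis
    using N cw_mass_pos[OF N]
    by (simp add: cw_weight_eq_mixture[OF N assms] cw_Z_eq[OF N] add_divide_distrib)
qed

lemma rest_nonneg: "\<sigma> \<in> configs N \<Longrightarrow> 0 \<le> rest \<sigma>"
  using cw_profile_pos spin_law_tanh_bounds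
  by (intro integral_nonneg_AE) (simp add: less_imp_le)

lemma sum_rest: "(\<Sum>\<sigma>\<in>configs N. rest \<sigma>) = cw_tail N a"
  unfolding cw_tail_def by (rule integral_spin_law_sum) (use N in \<open>auto simp: indicator_def\<close>)

text \<open>After truncation every mean is at most 1/2 in absolute value, so each of the N factors
  is at least 1/4. The second form keeps the atom separate, so that it can be cancelled in
  \<open>main_pos\<close>.\<close>

lemma mix_weight_ge:
  assumes "\<sigma> \<in> configs N"
  shows "(1/4) ^ N \<le> \<nu> \<sigma>" and "(1/4) ^ N * (1 - p) + p * (1/2) ^ N \<le> \<nu> \<sigma>"
proof -
  let ?L = "real N powr \<delta>"
  have q: "(1/4) ^ N \<le> spin_law N (y / root 4 (real N)) \<sigma>" "\<bar>spin_law N (y / root 4 (real N)) \<sigma>\<bar> \<le> 1"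
    if "y \<in> {- ?L..?L}" for y
  proof -
    have "\<bar>y\<bar> \<le> root 4 (real N) * (1/2)"
      using that cutoff_le_root by auto
    then have "\<bar>y / root 4 (real N)\<bar> \<le> 1/2"
      using root_pos by (simp add: pos_divide_le_eq mult.commute)
    moreover from this have "\<bar>y / root 4 (real N)\<bar> \<le> 1"
      by linarith
    moreover have "(1 - 1/2) / 2 = (1/4 :: real)"
      by simp
    ultimately show "(1/4) ^ N \<le> spin_law N (y / root 4 (real N)) \<sigma>" "\<bar>spin_law N (y / root 4 (real N)) \<sigma>\<bar> \<le> 1"
      using spin_law_bounds(1)[OF assms, of "y / root 4 (real N)" "1/2"]
        spin_law_unit_interval(3)[OF assms, of "y / root 4 (real N)"]
      by simp_all
  qed
  have "(1/4) ^ N * (1 - p) = (LINT y|lborel. (1/4) ^ N * (quartic_density y * indicator {- ?L..?L} y))"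
    by (simp add: quartic_density_interval)
  also have "\<dots> \<le> (LINT y|lborel. quartic_density y * (spin_law N (y / root 4 (real N)) \<sigma> * indicator {- ?L..?L} y))"
  proof (rule integral_mono)
    show "integrable lborel (\<lambda>y. (1/4) ^ N * (quartic_density y * indicator {- ?L..?L} y))"
      by (intro integrable_mult_right integrable_quartic_density_mult) (auto simp: indicator_def)
    show "integrable lborel (\<lambda>y. quartic_density y * (spin_law N (y / root 4 (real N)) \<sigma> * indicator {- ?L..?L} y))"
      using q(2) by (intro integrable_quartic_density_mult) (auto simp: indicator_def)
    show "(1/4) ^ N * (quartic_density y * indicator {- ?L..?L} y)
      \<le> quartic_density y * (spin_law N (y / root 4 (real N)) \<sigma> * indicator {- ?L..?L} y)" for y
      using mult_left_mono[OF q(1) quartic_density_nonneg, of y y]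
      by (auto simp: indicator_def mult.commute)
  qed
  finally show 1: "(1/4) ^ N * (1 - p) + p * (1/2) ^ N \<le> \<nu> \<sigma>"
    unfolding mix_weight_split[OF assms] by (simp add: mult.assoc)
  have "p * (1/4) ^ N \<le> p * (1/2) ^ N"
    by (intro mult_left_mono power_mono quartic_tail_nonneg) auto
  with 1 show "(1/4) ^ N \<le> \<nu> \<sigma>"
    by (simp add: algebra_simps)
qed

lemma mix_weight_pos: "\<sigma> \<in> configs N \<Longrightarrow> 0 < \<nu> \<sigma>"
  by (rule less_le_trans[OF _ mix_weight_ge(1)]) simp

lemma main_pos:
  assumes "\<sigma> \<in> configs N" "p < 1"
  shows "0 < main \<sigma>"
proof -
  have "0 < (1/4) ^ N * (1 - p)"
    using assms by simp
  also have "\<dots> \<le> \<kappa> * up * main \<sigma>"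
    using mix_weight_ge(2)[OF assms(1)] mix_weight_bounds(2)[OF assms(1)] by linarith
  finally show ?thesis
    by (rule zero_less_mult_pos) (rule \<kappa>_up_pos)
qed

lemma main_nonneg: "\<sigma> \<in> configs N \<Longrightarrow> 0 \<le> main \<sigma>"
  unfolding main_part_def using cw_profile_pos spin_law_tanh_bounds
  by (intro integral_nonneg_AE) (simp add: less_imp_le)

lemma cw_prob_pos: "0 < \<mu> \<sigma>"
  using cw_Z_pos[of N] by (simp add: cw_weight_def)

lemma sum_cw_prob: "(\<Sum>\<sigma>\<in>configs N. \<mu> \<sigma>) = 1"
  using cw_Z_pos[of N] by (simp add: cw_Z_def flip: sum_divide_distrib)

lemma sum_mix_weight: "(\<Sum>\<sigma>\<in>configs N. \<nu> \<sigma>) = 1"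
proof -
  let ?L = "real N powr \<delta>"
  have "integrable lborel (\<lambda>y. quartic_density y * (spin_law N (y / root 4 (real N)) \<sigma> * indicator {- ?L..?L} y))"
    if "\<sigma> \<in> configs N" for \<sigma>
  proof (rule integrable_quartic_density_mult)
    show "\<bar>spin_law N (y / root 4 (real N)) \<sigma> * indicator {- ?L..?L} y\<bar> \<le> 1" for y
    proof (cases "y \<in> {- ?L..?L}")
      case True
      then have "\<bar>y\<bar> \<le> root 4 (real N) * 1"
        using cutoff_le_root root_pos by auto
      then have "\<bar>y / root 4 (real N)\<bar> \<le> 1"
        using root_pos by (simp add: pos_divide_le_eq)
      from spin_law_unit_interval(3)[OF that this] show ?thesis
        using True by simp
    qed simp
  qed simp
  then have "(\<Sum>\<sigma>\<in>configs N. (LINT y|lborel. quartic_density y * (spin_law N (y / root 4 (real N)) \<sigma> *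
      indicator {- ?L..?L} y)))
    = (LINT y|lborel. (\<Sum>\<sigma>\<in>configs N. quartic_density y * (spin_law N (y / root 4 (real N)) \<sigma> *
      indicator {- ?L..?L} y)))"
    by (rule Bochner_Integration.integral_sum[symmetric])
  also have "\<dots> = (LINT y|lborel. quartic_density y * indicator {- ?L..?L} y)"
    by (simp add: sum_spin_law flip: sum_distrib_left sum_distrib_right)
  \<comment> \<open>The uniform weight of the atom is rewritten as the spin law of mean 0, so that
    the normalization of spin laws covers it too.\<close>
  finally have "(\<Sum>\<sigma>\<in>configs N. \<nu> \<sigma>) = 1 - p + (\<Sum>\<sigma>\<in>configs N. p * spin_law N 0 \<sigma>)"
    by (simp add: mix_weight_split sum.distrib quartic_density_interval spin_law_0 mult.assoc)
  then show ?thesis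
    by (simp add: sum_spin_law flip: sum_distrib_left)
qed

text \<open>The continuous part of \<open>\<nu>\<close> is at most
  \<open>\<kappa> * up * main \<sigma>\<close>, where \<open>main \<sigma>\<close> is at most
  \<open>cw_mass N * \<mu> \<sigma>\<close> and \<open>mass_bounds\<close> controls
  \<open>\<kappa> * cw_mass N\<close>. The atom is compared with \<open>\<mu>\<close>
  separately.\<close>

lemma mix_weight_le_cw:
  assumes \<sigma>: "\<sigma> \<in> configs N"
  shows "\<nu> \<sigma> \<le> (up * (1 / low + \<kappa> * cw_tail N a) + p * (sqrt (real N / (2 * pi)) * cw_mass 1)) * \<mu> \<sigma>"
proof -
  note W = cw_mass_pos[OF N]
  have "main \<sigma> \<le> cw_mass N * \<mu> \<sigma>"
    using cw_weight_split[OF \<sigma>] rest_nonneg[OF \<sigma>] W by (simp add: field_simps)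
  then have "\<kappa> * up * main \<sigma> \<le> \<kappa> * up * (cw_mass N * \<mu> \<sigma>)"
    using \<kappa>_up_pos by (intro mult_left_mono) auto
  also have "\<dots> = up * (\<kappa> * cw_mass N) * \<mu> \<sigma>"
    by simp
  also have "\<dots> \<le> up * (1 / low + \<kappa> * cw_tail N a) * \<mu> \<sigma>"
  proof -
    have "low * (\<kappa> * (cw_mass N - cw_tail N a)) \<le> 1"
      using mass_bounds(1) quartic_tail_nonneg[of "real N powr \<delta>"] by (simp add: mult_ac)
    then have "\<kappa> * (cw_mass N - cw_tail N a) \<le> 1 / low"
      using low_pos by (simp add: pos_le_divide_eq mult.commute)
    then have "\<kappa> * cw_mass N \<le> 1 / low + \<kappa> * cw_tail N a"
      by (simp add: right_diff_distrib)
    then show ?thesis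
      using cw_prob_pos[of \<sigma>] by (intro mult_right_mono mult_left_mono) auto
  qed
  finally have 1: "\<kappa> * up * main \<sigma> \<le> up * (1 / low + \<kappa> * cw_tail N a) * \<mu> \<sigma>" .
  \<comment> \<open>For the atom: the exponent of \<open>cw_weight\<close> is a square up to a
    nonnegative factor, so \<open>cw_weight\<close> is at least 1 and \<open>\<mu>\<close> is at
    least 1 / \<open>cw_Z N\<close>. This exceeds 2^-N up to a loss of order sqrt N only.\<close>
  have "(1/2) ^ N * cw_Z N = sqrt (real N / (2 * pi)) * cw_mass N"
    by (simp add: cw_Z_eq[OF N] power_one_over)
  also have "\<dots> \<le> sqrt (real N / (2 * pi)) * cw_mass 1"
    by (intro mult_left_mono cw_mass_le N) auto
  also have "\<dots> \<le> sqrt (real N / (2 * pi)) * cw_mass 1 * cw_weight N \<sigma>"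
  proof -
    have "0 \<le> (\<Sum>i\<in>{1..N}. \<Sum>j\<in>{1..N}. \<sigma> i * \<sigma> j)"
      by (simp flip: sum_product)
    then have "1 \<le> cw_weight N \<sigma>"
      by (simp add: cw_weight_def)
    then show ?thesis
      using cw_mass_pos[of 1] mult_left_mono[of 1 "cw_weight N \<sigma>" "sqrt (real N / (2 * pi)) * cw_mass 1"]
      by simp
  qed
  finally have "(1/2) ^ N \<le> sqrt (real N / (2 * pi)) * cw_mass 1 * \<mu> \<sigma>"
    using cw_Z_pos[of N] by (simp add: pos_le_divide_eq)
  then have "p * (1/2) ^ N \<le> p * (sqrt (real N / (2 * pi)) * cw_mass 1 * \<mu> \<sigma>)"
    by (intro mult_left_mono quartic_tail_nonneg)
  with 1 mix_weight_bounds(2)[OF \<sigma>] show ?thesis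
    unfolding distrib_right mult.assoc by linarith
qed

lemma cw_mass_ge:
  assumes "p < 1"
  shows "(1 - p) / up \<le> \<kappa> * cw_mass N"
proof -
  have "1 - p \<le> \<kappa> * up * (cw_mass N - cw_tail N a)"
    by (rule mass_bounds)
  also have "\<dots> \<le> \<kappa> * up * cw_mass N"
    using \<kappa>_up_pos cw_tail_nonneg[of N a] by (intro mult_left_mono) auto
  finally show ?thesis
    by (simp add: pos_divide_le_eq mult_ac)
qed

text \<open>The lower bound \<open>cw_mass_ge\<close> trades the normalization
  \<open>cw_mass N\<close> for \<open>\<kappa>\<close>; then \<open>\<kappa> * main \<sigma>\<close>
  is compared with \<open>\<nu> \<sigma>\<close>, the atom being dropped.\<close>

lemma main_le_mix_weight:
  assumes \<sigma>: "\<sigma> \<in> configs N" and p: "p < 1"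
  shows "main \<sigma> / cw_mass N \<le> up / (low * (1 - p)) * \<nu> \<sigma>"
proof -
  have "main \<sigma> / cw_mass N * ((1 - p) / up) \<le> main \<sigma> / cw_mass N * (\<kappa> * cw_mass N)"
    using main_nonneg[OF \<sigma>] cw_mass_pos[OF N] by (intro mult_left_mono cw_mass_ge p) auto
  also have "\<dots> = \<kappa> * main \<sigma>"
    using cw_mass_pos[OF N] by simp
  also have "\<dots> \<le> \<nu> \<sigma> / low"
  proof -
    have "0 \<le> p * (1/2) ^ N"
      by (intro mult_nonneg_nonneg quartic_tail_nonneg) simp
    then have "\<kappa> * low * main \<sigma> \<le> \<nu> \<sigma>"
      using mix_weight_bounds(1)[OF \<sigma>] by linarith
    then show ?thesis
      using low_pos by (simp add: pos_le_divide_eq mult_ac)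
  qed
  finally have "main \<sigma> / cw_mass N * ((1 - p) / up) * (up / (1 - p)) \<le> \<nu> \<sigma> / low * (up / (1 - p))"
    using p by (intro mult_right_mono) auto
  then show ?thesis
    using p by (simp add: mult_ac)
qed

lemma tail_fraction_le:
  assumes p: "p < 1"
  shows "cw_tail N a / cw_mass N \<le> \<kappa> * cw_tail N a * up / (1 - p)"
proof -
  have "cw_tail N a / cw_mass N * ((1 - p) / up) \<le> cw_tail N a / cw_mass N * (\<kappa> * cw_mass N)"
    using cw_tail_nonneg[of N a] cw_mass_pos[OF N] by (intro mult_left_mono cw_mass_ge p) auto
  also have "\<dots> = \<kappa> * cw_tail N a"
    using cw_mass_pos[OF N] by simp
  finally have "cw_tail N a / cw_mass N * ((1 - p) / up) * (up / (1 - p)) \<le> \<kappa> * cw_tail N a * (up / (1 - p))"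
    using p by (intro mult_right_mono) auto
  then show ?thesis
    using p by simp
qed

section \<open>Relative entropy bounds for a fixed number of spins\<close>

lemma rel_entropy_mix_cw_eq:
  "rel_entropy (mix_measure M (trunc_rv \<xi> \<delta> N) N) (cw_measure N)
    = ereal (\<Sum>\<sigma>\<in>configs N. \<nu> \<sigma> * ln (\<nu> \<sigma> / \<mu> \<sigma>))"
  unfolding mix_measure_def cw_measure_def
  by (rule rel_entropy_point_measure[OF finite_configs mix_weight_pos cw_prob_pos])

lemma rel_entropy_cw_mix_eq:
  "rel_entropy (cw_measure N) (mix_measure M (trunc_rv \<xi> \<delta> N) N)
    = ereal (\<Sum>\<sigma>\<in>configs N. \<mu> \<sigma> * ln (\<mu> \<sigma> / \<nu> \<sigma>))"
  unfolding mix_measure_def cw_measure_def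
  by (rule rel_entropy_point_measure[OF finite_configs cw_prob_pos mix_weight_pos])

lemma rel_entropy_mix_cw_nonneg:
  "0 \<le> rel_entropy (mix_measure M (trunc_rv \<xi> \<delta> N) N) (cw_measure N)"
proof -
  have "0 \<le> (\<Sum>\<sigma>\<in>configs N. \<nu> \<sigma> * ln (\<nu> \<sigma> / \<mu> \<sigma>))"
    by (rule relative_entropy_sum_nonneg)
       (simp_all only: mix_weight_pos cw_prob_pos sum_mix_weight sum_cw_prob)
  then show ?thesis
    unfolding rel_entropy_mix_cw_eq by simp
qed

lemma rel_entropy_cw_mix_nonneg:
  "0 \<le> rel_entropy (cw_measure N) (mix_measure M (trunc_rv \<xi> \<delta> N) N)"
proof -
  have "0 \<le> (\<Sum>\<sigma>\<in>configs N. \<mu> \<sigma> * ln (\<mu> \<sigma> / \<nu> \<sigma>))"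
    by (rule relative_entropy_sum_nonneg)
       (simp_all only: mix_weight_pos cw_prob_pos sum_mix_weight sum_cw_prob)
  then show ?thesis
    unfolding rel_entropy_cw_mix_eq by simp
qed

lemma rel_entropy_mix_cw_le:
  "rel_entropy (mix_measure M (trunc_rv \<xi> \<delta> N) N) (cw_measure N)
    \<le> ereal (ln (up * (1 / low + \<kappa> * cw_tail N a) + p * (sqrt (real N / (2 * pi)) * cw_mass 1)))"
  unfolding rel_entropy_mix_cw_eq ereal_less_eq(3)
  by (rule relative_entropy_sum_le_ln[OF mix_weight_pos cw_prob_pos sum_mix_weight mix_weight_le_cw])

text \<open>Here \<open>\<mu>\<close> is split at a into its main part, dominated by
  \<open>\<nu>\<close> up to a factor near 1, and the rest, which is charged with the crude exponent
  N ln 4 but has tiny total mass.\<close>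

lemma rel_entropy_cw_mix_le:
  assumes p: "p < 1"
  shows "rel_entropy (cw_measure N) (mix_measure M (trunc_rv \<xi> \<delta> N) N)
    \<le> ereal (ln (up / (low * (1 - p))) + (1 + real N * ln 4) * (\<kappa> * cw_tail N a * up / (1 - p)))"
proof -
  note W = cw_mass_pos[OF N]
  have "low * (1 - p) \<le> 1 * 1"
    using p low_pos quartic_tail_nonneg[of "real N powr \<delta>"] by (intro mult_mono) auto
  moreover have "1 \<le> up"
    using a by simp
  moreover have "0 < low * (1 - p)"
    using p low_pos by (intro mult_pos_pos) auto
  ultimately have "1 \<le> up / (low * (1 - p))"
    by (subst pos_le_divide_eq) linarith+
  moreover have "\<mu> \<sigma> \<le> exp (real N * ln 4) * \<nu> \<sigma>" if "\<sigma> \<in> configs N" for \<sigma>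
  proof -
    \<comment> \<open>A probability is at most 1 = 4^N 4^-N, and 4^-N is the uniform lower bound for
      \<open>\<nu>\<close>.\<close>
    have "\<mu> \<sigma> \<le> (\<Sum>\<sigma>\<in>configs N. \<mu> \<sigma>)"
      using cw_prob_pos by (intro member_le_sum that finite_configs) (auto simp: less_imp_le)
    also have "\<dots> = 4 ^ N * (1/4) ^ N"
      by (simp add: sum_cw_prob flip: power_mult_distrib)
    also have "\<dots> \<le> 4 ^ N * \<nu> \<sigma>"
      by (intro mult_left_mono mix_weight_ge that) auto
    finally show ?thesis
      by (simp add: exp_of_nat_mult)
  qed
  ultimately have "(\<Sum>\<sigma>\<in>configs N. (main \<sigma> / cw_mass N + rest \<sigma> / cw_mass N) *
      ln ((main \<sigma> / cw_mass N + rest \<sigma> / cw_mass N) / \<nu> \<sigma>))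
    \<le> ln (up / (low * (1 - p))) + (1 + real N * ln 4) * (\<Sum>\<sigma>\<in>configs N. rest \<sigma> / cw_mass N)"
    using W main_pos[OF _ p] rest_nonneg sum_cw_prob main_le_mix_weight[OF _ p] mix_weight_pos
    by (intro relative_entropy_sum_le_ln_plus_tail) (auto simp: cw_weight_split)
  also have "(\<Sum>\<sigma>\<in>configs N. rest \<sigma> / cw_mass N) = cw_tail N a / cw_mass N"
    by (simp add: sum_rest flip: sum_divide_distrib)
  also have "ln (up / (low * (1 - p))) + (1 + real N * ln 4) * (cw_tail N a / cw_mass N)
    \<le> ln (up / (low * (1 - p))) + (1 + real N * ln 4) * (\<kappa> * cw_tail N a * up / (1 - p))"
    by (intro add_left_mono mult_left_mono tail_fraction_le p) auto
  finally have "(\<Sum>\<sigma>\<in>configs N. \<mu> \<sigma> * ln (\<mu> \<sigma> / \<nu> \<sigma>))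
    \<le> ln (up / (low * (1 - p))) + (1 + real N * ln 4) * (\<kappa> * cw_tail N a * up / (1 - p))"
    by (simp add: cw_weight_split cong: sum.cong)
  then show ?thesis
    unfolding rel_entropy_cw_mix_eq by simp
qed

end

section \<open>Asymptotics\<close>

context
  fixes \<delta> :: real
  assumes \<delta>: "0 < \<delta>" "\<delta> < 1/20"
begin

abbreviation "s N \<equiv> real N powr (\<delta> - 1/4)"
abbreviation "cutoff N \<equiv> artanh (s N)"

text \<open>Supplies the assumptions of \<open>cw_mixture_comparison\<close> for a =
  \<open>cutoff N\<close>. Since \<delta> < 1/4, \<open>s N\<close> tends to 0, hence is eventually
  below 1/2, where \<open>artanh\<close> inverts \<open>tanh\<close>.\<close>

lemma eventually_cutoff:
  "eventually (\<lambda>N. 2 \<le> N \<and> tanh (cutoff N) = s N \<and> 0 \<le> cutoff N \<and> s N \<le> 1/2 \<and>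
      root 4 (real N) * s N = real N powr \<delta>) sequentially"
proof -
  have "s \<longlonglongrightarrow> 0"
    using \<delta> by real_asymp
  then have "eventually (\<lambda>N. s N < 1/2) sequentially"
    by (rule order_tendstoD) simp
  then show ?thesis
    using eventually_ge_at_top[of 2]
  proof eventually_elim
    case (elim N)
    have tanh: "tanh (cutoff N) = s N"
      using elim by (intro tanh_artanh_real) simp
    then have "0 \<le> tanh (cutoff N)"
      by simp
    then have "0 \<le> cutoff N"
      by (simp only: tanh_real_nonneg_iff)
    moreover have "root 4 (real N) * s N = real N powr \<delta>"
      using elim by (simp add: root_powr_inverse flip: powr_add)
    ultimately show ?case
      using tanh elim by auto
  qed
qed

text \<open>By \<open>le_double_tanh\<close> the exponent is at most 64 N^(6\<delta> - 1/2), and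
  this power is negative for \<delta> < 1/20.\<close>

lemma up_tendsto: "(\<lambda>N. exp (real N * cutoff N ^ 6)) \<longlonglongrightarrow> 1"
proof -
  have "(\<lambda>N. real N * cutoff N ^ 6) \<longlonglongrightarrow> 0"
  proof (rule tendsto_sandwich[where f = "\<lambda>_. 0"])
    show "(\<lambda>N. real N * (2 * s N) ^ 6) \<longlonglongrightarrow> 0"
      using \<delta> by real_asymp
    show "eventually (\<lambda>N. real N * cutoff N ^ 6 \<le> real N * (2 * s N) ^ 6) sequentially"
      using eventually_cutoff
    proof eventually_elim
      case (elim N)
      then show ?case
        using le_double_tanh[of "cutoff N"] by (intro mult_left_mono power_mono) auto
    qed
    show "eventually (\<lambda>N. 0 \<le> real N * cutoff N ^ 6) sequentially"
      by (intro always_eventually allI) simp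
  qed simp
  then show ?thesis
    using tendsto_exp[of _ 0] by fastforce
qed

lemma low_tendsto: "(\<lambda>N. 1 - tanh (cutoff N) ^ 2) \<longlonglongrightarrow> 1"
proof -
  have "(\<lambda>N. 1 - s N ^ 2) \<longlonglongrightarrow> 1"
    using \<delta> by real_asymp
  then show ?thesis
    by (rule Lim_transform_eventually) (use eventually_cutoff in eventually_elim, simp)
qed

lemma quartic_tail_scaled_tendsto:
  fixes f :: "nat \<Rightarrow> real"
  assumes f: "\<And>N. 0 \<le> f N"
    and lim: "(\<lambda>N. exp (- ((real N powr \<delta>) ^ 4 / 24)) * f N) \<longlonglongrightarrow> 0"
  shows "(\<lambda>N. quartic_tail (real N powr \<delta>) * f N) \<longlonglongrightarrow> 0"
proof (rule tendsto_sandwich[where f = "\<lambda>_. 0"])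
  let ?C = "(LINT y|lborel. exp (- (1/24) * y ^ 4)) / quartic_Z"
  show "(\<lambda>N. ?C * (exp (- ((real N powr \<delta>) ^ 4 / 24)) * f N)) \<longlonglongrightarrow> 0"
    using tendsto_mult_left[OF lim, of ?C] by simp
  show "eventually (\<lambda>N. quartic_tail (real N powr \<delta>) * f N
      \<le> ?C * (exp (- ((real N powr \<delta>) ^ 4 / 24)) * f N)) sequentially"
    unfolding mult.assoc[symmetric]
    by (intro always_eventually allI mult_right_mono quartic_tail_le f) simp
  show "eventually (\<lambda>N. 0 \<le> quartic_tail (real N powr \<delta>) * f N) sequentially"
    by (intro always_eventually allI mult_nonneg_nonneg quartic_tail_nonneg f)
qed simp

text \<open>Reduces the tail to an explicit expression. As (N - 1) \<open>s N ^ 4\<close> is of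
  order N^(4\<delta>), the exponential beats every polynomial weight f, in particular the factor 1 +
  N ln 4.\<close>

lemma cw_tail_scaled_tendsto:
  fixes f :: "nat \<Rightarrow> real"
  assumes f: "\<And>N. 0 \<le> f N"
    and lim: "(\<lambda>N. f N * (root 4 (real N) * exp (- (real (N - 1) * s N ^ 4 / 12)))) \<longlonglongrightarrow> 0"
  shows "(\<lambda>N. f N * (quartic_scale N * cw_tail N (cutoff N))) \<longlonglongrightarrow> 0"
proof (rule tendsto_sandwich[where f = "\<lambda>_. 0"])
  let ?e = "\<lambda>N. exp (- (real (N - 1) * s N ^ 4 / 12))"
  let ?C = "cw_mass 1 / quartic_Z"
  show "(\<lambda>N. ?C * (f N * (root 4 (real N) * ?e N))) \<longlonglongrightarrow> 0"
    using tendsto_mult_left[OF lim, of ?C] by simp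
  show "eventually (\<lambda>N. f N * (quartic_scale N * cw_tail N (cutoff N))
      \<le> ?C * (f N * (root 4 (real N) * ?e N))) sequentially"
    using eventually_cutoff
  proof eventually_elim
    case (elim N)
    then have "cw_tail N (cutoff N) \<le> cw_mass 1 * ?e N"
      using cw_tail_le[of N "cutoff N"] by (simp add: cw_tail_def)
    then have "f N * (quartic_scale N * cw_tail N (cutoff N)) \<le> f N * (quartic_scale N * (cw_mass 1 * ?e N))"
      using f quartic_Z_pos by (intro mult_left_mono) (auto simp: quartic_scale_def)
    then show ?case
      by (simp add: quartic_scale_def mult_ac)
  qed
  show "eventually (\<lambda>N. 0 \<le> f N * (quartic_scale N * cw_tail N (cutoff N))) sequentially"
    using quartic_Z_pos f cw_tail_nonneg
    by (intro always_eventually allI mult_nonneg_nonneg) (auto simp: quartic_scale_def)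
qed simp

lemma quartic_tail_tendsto: "(\<lambda>N. quartic_tail (real N powr \<delta>)) \<longlonglongrightarrow> 0"
proof -
  have "(\<lambda>N. exp (- ((real N powr \<delta>) ^ 4 / 24)) * 1) \<longlonglongrightarrow> 0"
    using \<delta> by real_asymp
  from quartic_tail_scaled_tendsto[OF _ this] show ?thesis by simp
qed

lemma mix_cw_bound_tendsto:
  "(\<lambda>N. ln (exp (real N * cutoff N ^ 6) *
      (1 / (1 - tanh (cutoff N) ^ 2) + quartic_scale N * cw_tail N (cutoff N)) +
      quartic_tail (real N powr \<delta>) * (sqrt (real N / (2 * pi)) * cw_mass 1))) \<longlonglongrightarrow> 0"
proof -
  have "(\<lambda>N. exp (- ((real N powr \<delta>) ^ 4 / 24)) * sqrt (real N / (2 * pi))) \<longlonglongrightarrow> 0"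
    using \<delta> by real_asymp
  from tendsto_mult_right[OF quartic_tail_scaled_tendsto[OF _ this], of "cw_mass 1"]
  have 1: "(\<lambda>N. quartic_tail (real N powr \<delta>) * (sqrt (real N / (2 * pi)) * cw_mass 1)) \<longlonglongrightarrow> 0"
    by (simp add: mult.assoc)
  have "(\<lambda>N. 1 * (root 4 (real N) * exp (- (real (N - 1) * s N ^ 4 / 12)))) \<longlonglongrightarrow> 0"
    using \<delta> by real_asymp
  from cw_tail_scaled_tendsto[OF _ this]
  have 2: "(\<lambda>N. quartic_scale N * cw_tail N (cutoff N)) \<longlonglongrightarrow> 0"
    by simp
  have "(\<lambda>N. ln (exp (real N * cutoff N ^ 6) *
      (1 / (1 - tanh (cutoff N) ^ 2) + quartic_scale N * cw_tail N (cutoff N)) +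
      quartic_tail (real N powr \<delta>) * (sqrt (real N / (2 * pi)) * cw_mass 1)))
    \<longlonglongrightarrow> ln (1 * (1 / 1 + 0) + 0)"
    by (intro tendsto_intros up_tendsto low_tendsto 1 2) simp_all
  then show ?thesis by simp
qed

lemma cw_mix_bound_tendsto:
  "(\<lambda>N. ln (exp (real N * cutoff N ^ 6) / ((1 - tanh (cutoff N) ^ 2) * (1 - quartic_tail (real N powr \<delta>))))
    + (1 + real N * ln 4) * (quartic_scale N * cw_tail N (cutoff N) * exp (real N * cutoff N ^ 6)
        / (1 - quartic_tail (real N powr \<delta>)))) \<longlonglongrightarrow> 0"
proof -
  have "(\<lambda>N. (1 + real N * ln 4) *
      (root 4 (real N) * exp (- (real (N - 1) * s N ^ 4 / 12)))) \<longlonglongrightarrow> 0"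
    using \<delta> by real_asymp
  then have 1: "(\<lambda>N. (1 + real N * ln 4) * (quartic_scale N * cw_tail N (cutoff N))) \<longlonglongrightarrow> 0"
    by (intro cw_tail_scaled_tendsto) auto
  have "(\<lambda>N. ln (exp (real N * cutoff N ^ 6) / ((1 - tanh (cutoff N) ^ 2) * (1 - quartic_tail (real N powr \<delta>))))
      + ((1 + real N * ln 4) * (quartic_scale N * cw_tail N (cutoff N))) * exp (real N * cutoff N ^ 6)
        / (1 - quartic_tail (real N powr \<delta>))) \<longlonglongrightarrow> ln (1 / (1 * (1 - 0))) + 0 * 1 / (1 - 0)"
    by (intro tendsto_intros up_tendsto low_tendsto quartic_tail_tendsto 1) simp_all
  then show ?thesis
    by (simp add: mult.assoc)
qed

lemma rel_entropy_tendsto: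
  assumes dist: "distributed M lborel \<xi> (\<lambda>x. ennreal (quartic_density x))"
  shows "(\<lambda>N. rel_entropy (cw_measure N) (mix_measure M (trunc_rv \<xi> \<delta> N) N)) \<longlonglongrightarrow> 0"
    and "(\<lambda>N. rel_entropy (mix_measure M (trunc_rv \<xi> \<delta> N) N) (cw_measure N)) \<longlonglongrightarrow> 0"
proof -
  have comparison: "eventually (\<lambda>N. cw_mixture_comparison M \<xi> \<delta> (cutoff N) N) sequentially"
    using eventually_cutoff by eventually_elim (auto simp: cw_mixture_comparison_def dist)
  have p: "eventually (\<lambda>N. quartic_tail (real N powr \<delta>) < 1) sequentially"
    using quartic_tail_tendsto by (rule order_tendstoD) simp
  show "(\<lambda>N. rel_entropy (cw_measure N) (mix_measure M (trunc_rv \<xi> \<delta> N) N)) \<longlonglongrightarrow> 0"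
  proof (rule tendsto_sandwich[where f = "\<lambda>_. 0"])
    show "eventually (\<lambda>N. 0 \<le> rel_entropy (cw_measure N) (mix_measure M (trunc_rv \<xi> \<delta> N) N)) sequentially"
      using comparison by eventually_elim (rule cw_mixture_comparison.rel_entropy_cw_mix_nonneg)
    show "eventually (\<lambda>N. rel_entropy (cw_measure N) (mix_measure M (trunc_rv \<xi> \<delta> N) N) \<le> ereal (
        ln (exp (real N * cutoff N ^ 6) / ((1 - tanh (cutoff N) ^ 2) * (1 - quartic_tail (real N powr \<delta>))))
        + (1 + real N * ln 4) * (quartic_scale N * cw_tail N (cutoff N) * exp (real N * cutoff N ^ 6)
        / (1 - quartic_tail (real N powr \<delta>))))) sequentially"
      using comparison p by eventually_elim (rule cw_mixture_comparison.rel_entropy_cw_mix_le)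
  qed (use cw_mix_bound_tendsto in \<open>simp_all add: zero_ereal_def\<close>)
  show "(\<lambda>N. rel_entropy (mix_measure M (trunc_rv \<xi> \<delta> N) N) (cw_measure N)) \<longlonglongrightarrow> 0"
  proof (rule tendsto_sandwich[where f = "\<lambda>_. 0"])
    show "eventually (\<lambda>N. 0 \<le> rel_entropy (mix_measure M (trunc_rv \<xi> \<delta> N) N) (cw_measure N)) sequentially"
      using comparison by eventually_elim (rule cw_mixture_comparison.rel_entropy_mix_cw_nonneg)
    show "eventually (\<lambda>N. rel_entropy (mix_measure M (trunc_rv \<xi> \<delta> N) N) (cw_measure N) \<le> ereal (
        ln (exp (real N * cutoff N ^ 6) *
        (1 / (1 - tanh (cutoff N) ^ 2) + quartic_scale N * cw_tail N (cutoff N)) +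
        quartic_tail (real N powr \<delta>) * (sqrt (real N / (2 * pi)) * cw_mass 1)))) sequentially"
      using comparison by eventually_elim (rule cw_mixture_comparison.rel_entropy_mix_cw_le)
  qed (use mix_cw_bound_tendsto in \<open>simp_all add: zero_ereal_def\<close>)
qed

end

theorem theorem4p4:
  fixes M :: "'w measure" and \<xi> :: "'w \<Rightarrow> real"
  assumes "prob_space M"
    and "distributed M lborel \<xi> (\<lambda>x. ennreal (quartic_density x))"
  shows "\<exists>\<delta>0::real. 0 < \<delta>0 \<and> \<delta>0 \<le> 1/20 \<and>
    (\<forall>\<delta>::real. 0 < \<delta> \<and> \<delta> < \<delta>0 \<longrightarrow>
      (\<lambda>N. rel_entropy (cw_measure N) (mix_measure M (trunc_rv \<xi> \<delta> N) N)) \<longlonglongrightarrow> 0 \<and>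
      (\<lambda>N. rel_entropy (mix_measure M (trunc_rv \<xi> \<delta> N) N) (cw_measure N)) \<longlonglongrightarrow> 0)"
  \<comment> \<open>The witness 1/20 is the largest value the statement admits.\<close>
  using rel_entropy_tendsto[OF _ _ assms(2)] by (intro exI[of _ "1/20"]) auto

end
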